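(* Let $\mu_0\neq\mu_1$ in $\mathcal M$ and let $(\mu_t,V_t,h_t)_{t\in[0,1]}\in\mathcal{CE}_p(\mu_0,\mu_1;[0,1])$ satisfy $$\mathfrak E^{a,b}_{\rm Quad}\big((\mu_t,V_t,h_t)_{t\in[0,1]}\big)=\mathcal W^{a,b}_p(\mu_0,\mu_1)^2 .$$ Then $\mu_t\in\mathcal M_+$ for a.e. $t\in[0,1]$.
   Context: Setting. $\mathcal X$ is a finite set, $K:\mathcal X\times\mathcal X\to[0,\infty)$ an irreducible Markov kernel ($\sum_y K(x,y)=1$) with unique invariant probability $\varpi$ ($\varpi(x)=\sum_y\varpi(y)K(y,x)$, $\sum_y\varpi(y)=1$), assumed reversible: $K(x,y)\varpi(x)=K(y,x)\varpi(y)$. $\mathcal M$ is the set of $\mu:\mathcal X\to[0,\infty)$ and $\mathcal M_+$ the set of $\mu:\mathcal X\to(0,\infty)$. Fix $a,b>0$ and $p\in\mathcal M_+$ with $\sum_x p(x)\varpi(x)=1$. Notation. $\nabla\psi(x,y)=\psi(y)-\psi(x)$ for $\psi\in\mathbb R^{\mathcal X}$; $(\nabla\cdot\Psi)(x)=\frac12\sum_y(\Psi(x,y)-\Psi(y,x))K(x,y)$ for $\Psi\in\mathbb R^{\mathcal X\times\mathcal X}$. Logarithmic mean: $\theta(u,v)=\int_0^1u^\xi v^{1-\xi}\,d\xi$ for $u,v\ge0$, i.e. $\theta(u,u)=u$, $\theta(u,v)=\frac{u-v}{\log u-\log v}$ for $u\ne v$ positive, and $\theta(u,v)=0$ if $u=0$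 or $v=0$. $\hat\mu(x,y)=\theta(\mu(x),\mu(y))$. Metric. $\mathcal W^{a,b}_p(\mu_0,\mu_1)^2$ is the infimum of $a^2\int_0^1h_t^2\,dt+b^2\int_0^1\frac12\sum_{x,y}(\psi_t(y)-\psi_t(x))^2\hat\mu_t(x,y)K(x,y)\varpi(x)\,dt$ over all triples $(\mu_t,\psi_t,h_t)_{t\in[0,1]}$ with $t\mapsto\mu_t\in\mathcal M$ absolutely continuous on $[0,1]$ with the given endpoints $\mu_0,\mu_1$, $\psi:[0,1]\to\mathbb R^{\mathcal X}$ and $h:[0,1]\to\mathbb R$ measurable, and $\dot\mu_t(x)+\sum_y(\psi_t(y)-\psi_t(x))\hat\mu_t(x,y)K(x,y)=h_tp(x)$ for a.e. $t$ and all $x$. Flux formulation. $\mathcal{CE}_p(\mu_0,\mu_1;[0,1])$ is the set of triples $(\mu_t,V_t,h_t)_{t\in[0,1]}$ with $t\mapsto\mu_t\in\mathcal M$ absolutely continuous with endpoints $\mu_0$ (at $t=0$) and $\mu_1$ (at $t=1$), $V:[0,1]\to\mathbb R^{\mathcal X\times\mathcal X}$ and $h:[0,1]\to\mathbb R$ measurable, and $\dot\mu_t+\nabla\cdot V_t=h_tp$ for a.e. $t$. Let $\alpha(v,s,t)=v^2/\theta(s,t)$ for $v\in\mathbb R$, $s,t\ge0$, with $v^2/0=0$ if $v=0$ and $v^2/0=+\infty$ if $v\neq0$; $A'(\mu,V)=\frac12\sum_{x,y}\alpha(V(x,y),\mu(x),\mu(y))K(x,y)\varpi(x)$ (with $0\cdot\infty=0$);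 and $\mathfrak E^{a,b}_{\rm Quad}((\mu_t,V_t,h_t)_{t\in[0,1]})=a^2\int_0^1|h_t|^2dt+b^2\int_0^1A'(\mu_t,V_t)\,dt\in[0,\infty]$. *)

theory Defs
  imports "HOL-Analysis.Analysis"
begin

definition markov_kernel :: "('a::finite \<Rightarrow> 'a \<Rightarrow> real) \<Rightarrow> bool" where
  "markov_kernel K \<longleftrightarrow> (\<forall>x y. 0 \<le> K x y) \<and> (\<forall>x. (\<Sum>y\<in>UNIV. K x y) = 1)"

primrec kernel_power :: "('a::finite \<Rightarrow> 'a \<Rightarrow> real) \<Rightarrow> nat \<Rightarrow> 'a \<Rightarrow> 'a \<Rightarrow> real" where
  "kernel_power K 0 x y = (if x = y then 1 else 0)"
| "kernel_power K (Suc n) x y = (\<Sum>z\<in>UNIV. K x z * kernel_power K n z y)"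

definition irreducible_kernel :: "('a::finite \<Rightarrow> 'a \<Rightarrow> real) \<Rightarrow> bool" where
  "irreducible_kernel K \<longleftrightarrow> (\<forall>x y. \<exists>n. 0 < kernel_power K n x y)"

definition invariant_probability ::
    "('a::finite \<Rightarrow> 'a \<Rightarrow> real) \<Rightarrow> ('a \<Rightarrow> real) \<Rightarrow> bool" where
  "invariant_probability K w \<longleftrightarrow>
     (\<forall>x. 0 \<le> w x) \<and> (\<Sum>x\<in>UNIV. w x) = 1 \<and> (\<forall>x. w x = (\<Sum>y\<in>UNIV. w y * K y x))"

definition reversible_kernel :: "('a::finite \<Rightarrow> 'a \<Rightarrow> real) \<Rightarrow> ('a \<Rightarrow> real) \<Rightarrow> bool" where
  "reversible_kernel K w \<longleftrightarrow> (\<forall>x y. K x y * w x = K y x * w y)"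

definition densities :: "('a::finite \<Rightarrow> real) set" where
  "densities = {\<mu>. \<forall>x. 0 \<le> \<mu> x}"

definition pos_densities :: "('a::finite \<Rightarrow> real) set" where
  "pos_densities = {\<mu>. \<forall>x. 0 < \<mu> x}"

text \<open>The convention \<open>0 powr 0 = 0\<close> affects the integrand at most at the two endpoints.\<close>

definition log_mean :: "real \<Rightarrow> real \<Rightarrow> real" where
  "log_mean u v = integral {0..1} (\<lambda>\<xi>. u powr \<xi> * v powr (1 - \<xi>))"

lemma log_mean_0 [simp]: "log_mean 0 v = 0" "log_mean u 0 = 0"
  by (simp_all add: log_mean_def)

lemma log_mean_same [simp]: "0 \<le> u \<Longrightarrow> log_mean u u = u"
  by (simp add: log_mean_def flip: powr_add)

lemma log_mean_neq:
  assumes "0 < u" "0 < v" "u \<noteq> v"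
  shows "log_mean u v = (u - v) / (ln u - ln v)"
proof -
  define c where "c = ln u - ln v"
  have c: "c \<noteq> 0" using assms by (simp add: c_def)
  have eq: "u powr \<xi> * v powr (1 - \<xi>) = v * exp (\<xi> * c)" for \<xi>
    using assms by (simp add: powr_def c_def exp_diff exp_add algebra_simps)
  have "((\<lambda>\<xi>. v * exp (\<xi> * c)) has_integral (v * exp (1 * c) / c - v * exp (0 * c) / c)) {0..1}"
    using c by (intro fundamental_theorem_of_calculus)
      (auto intro!: derivative_eq_intros simp flip: has_real_derivative_iff_has_vector_derivative)
  moreover have "v * exp c = u"
    using assms by (simp add: c_def exp_diff)
  ultimately show ?thesis
    by (auto simp: log_mean_def eq diff_divide_distrib simp flip: c_def dest!: integral_unique)
qed

definition discrete_div ::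
    "('a::finite \<Rightarrow> 'a \<Rightarrow> real) \<Rightarrow> ('a \<Rightarrow> 'a \<Rightarrow> real) \<Rightarrow> 'a \<Rightarrow> real" where
  "discrete_div K \<Psi> x = (\<Sum>y\<in>UNIV. (\<Psi> x y - \<Psi> y x) * K x y) / 2"

text \<open>
  The usual \<open>\<epsilon>\<close>-\<open>\<delta>\<close> definition: a division of a subset of \<open>{l..r}\<close> is a finite family of
  non-overlapping compact intervals \<open>{Inf I..Sup I}\<close> contained in \<open>{l..r}\<close>.
\<close>

definition abs_continuous_on_interval :: "real \<Rightarrow> real \<Rightarrow> (real \<Rightarrow> real) \<Rightarrow> bool" where
  "abs_continuous_on_interval l r f \<longleftrightarrow>
     (\<forall>\<epsilon>>0. \<exists>\<delta>>0. \<forall>\<D> S. \<D> division_of S \<longrightarrow> S \<subseteq> {l..r} \<longrightarrow> (\<Sum>I\<in>\<D>. Sup I - Inf I) < \<delta> \<longrightarrow>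
        (\<Sum>I\<in>\<D>. \<bar>f (Sup I) - f (Inf I)\<bar>) < \<epsilon>)"

text \<open>Time-dependent objects are functions on \<open>real\<close>; only their values on \<open>{0..1}\<close> matter.\<close>

definition ac_curve_between ::
    "('a::finite \<Rightarrow> real) \<Rightarrow> ('a \<Rightarrow> real) \<Rightarrow> (real \<Rightarrow> 'a \<Rightarrow> real) \<Rightarrow> bool" where
  "ac_curve_between \<mu>0 \<mu>1 \<mu> \<longleftrightarrow>
     (\<forall>t\<in>{0..1}. \<mu> t \<in> densities) \<and>
     (\<forall>x. abs_continuous_on_interval 0 1 (\<lambda>t. \<mu> t x)) \<and> \<mu> 0 = \<mu>0 \<and> \<mu> 1 = \<mu>1"

definition potential_triples ::
    "('a::finite \<Rightarrow> 'a \<Rightarrow> real) \<Rightarrow> ('a \<Rightarrow> real) \<Rightarrow> ('a \<Rightarrow> real) \<Rightarrow> ('a \<Rightarrow> real) \<Rightarrow>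
     ((real \<Rightarrow> 'a \<Rightarrow> real) \<times> (real \<Rightarrow> 'a \<Rightarrow> real) \<times> (real \<Rightarrow> real)) set" where
  "potential_triples K p \<mu>0 \<mu>1 = {(\<mu>, \<psi>, h).
     ac_curve_between \<mu>0 \<mu>1 \<mu> \<and>
     (\<forall>x. (\<lambda>t. \<psi> t x) \<in> borel_measurable (lebesgue_on {0..1})) \<and>
     h \<in> borel_measurable (lebesgue_on {0..1}) \<and>
     (AE t in lebesgue_on {0..1}. \<forall>x.
        ((\<lambda>s. \<mu> s x) has_real_derivative
           h t * p x - (\<Sum>y\<in>UNIV. (\<psi> t y - \<psi> t x) * log_mean (\<mu> t x) (\<mu> t y) * K x y))
        (at t within {0..1}))}"

definition potential_energy ::
    "('a::finite \<Rightarrow> 'a \<Rightarrow> real) \<Rightarrow> ('a \<Rightarrow> real) \<Rightarrow> real \<Rightarrow> real \<Rightarrow>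
     (real \<Rightarrow> 'a \<Rightarrow> real) \<Rightarrow> (real \<Rightarrow> 'a \<Rightarrow> real) \<Rightarrow> (real \<Rightarrow> real) \<Rightarrow> ennreal" where
  "potential_energy K w a b \<mu> \<psi> h =
     ennreal (a\<^sup>2) * (\<integral>\<^sup>+ t. ennreal ((h t)\<^sup>2) \<partial>lebesgue_on {0..1}) +
     ennreal (b\<^sup>2) * (\<integral>\<^sup>+ t. ennreal ((\<Sum>x\<in>UNIV. \<Sum>y\<in>UNIV.
        (\<psi> t y - \<psi> t x)\<^sup>2 * log_mean (\<mu> t x) (\<mu> t y) * K x y * w x) / 2) \<partial>lebesgue_on {0..1})"

definition W_squared ::
    "('a::finite \<Rightarrow> 'a \<Rightarrow> real) \<Rightarrow> ('a \<Rightarrow> real) \<Rightarrow> ('a \<Rightarrow> real) \<Rightarrow> real \<Rightarrow> real \<Rightarrow>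
     ('a \<Rightarrow> real) \<Rightarrow> ('a \<Rightarrow> real) \<Rightarrow> ennreal" where
  "W_squared K w p a b \<mu>0 \<mu>1 =
     (INF (\<mu>, \<psi>, h)\<in>potential_triples K p \<mu>0 \<mu>1. potential_energy K w a b \<mu> \<psi> h)"

definition CE ::
    "('a::finite \<Rightarrow> 'a \<Rightarrow> real) \<Rightarrow> ('a \<Rightarrow> real) \<Rightarrow> ('a \<Rightarrow> real) \<Rightarrow> ('a \<Rightarrow> real) \<Rightarrow>
     ((real \<Rightarrow> 'a \<Rightarrow> real) \<times> (real \<Rightarrow> 'a \<Rightarrow> 'a \<Rightarrow> real) \<times> (real \<Rightarrow> real)) set" where
  "CE K p \<mu>0 \<mu>1 = {(\<mu>, V, h).
     ac_curve_between \<mu>0 \<mu>1 \<mu> \<and>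
     (\<forall>x y. (\<lambda>t. V t x y) \<in> borel_measurable (lebesgue_on {0..1})) \<and>
     h \<in> borel_measurable (lebesgue_on {0..1}) \<and>
     (AE t in lebesgue_on {0..1}. \<forall>x.
        ((\<lambda>s. \<mu> s x) has_real_derivative h t * p x - discrete_div K (V t) x)
        (at t within {0..1}))}"

definition action_density :: "real \<Rightarrow> real \<Rightarrow> real \<Rightarrow> ennreal" where
  "action_density v s t =
     (if log_mean s t = 0 then (if v = 0 then 0 else \<infinity>) else ennreal (v\<^sup>2 / log_mean s t))"

definition flux_action ::
    "('a::finite \<Rightarrow> 'a \<Rightarrow> real) \<Rightarrow> ('a \<Rightarrow> real) \<Rightarrow> ('a \<Rightarrow> real) \<Rightarrow> ('a \<Rightarrow> 'a \<Rightarrow> real) \<Rightarrow> ennreal" where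
  "flux_action K w \<mu> V =
     (\<Sum>x\<in>UNIV. \<Sum>y\<in>UNIV. action_density (V x y) (\<mu> x) (\<mu> y) * ennreal (K x y) * ennreal (w x)) / 2"

definition E_Quad ::
    "('a::finite \<Rightarrow> 'a \<Rightarrow> real) \<Rightarrow> ('a \<Rightarrow> real) \<Rightarrow> real \<Rightarrow> real \<Rightarrow>
     (real \<Rightarrow> 'a \<Rightarrow> real) \<Rightarrow> (real \<Rightarrow> 'a \<Rightarrow> 'a \<Rightarrow> real) \<Rightarrow> (real \<Rightarrow> real) \<Rightarrow> ennreal" where
  "E_Quad K w a b \<mu> V h =
     ennreal (a\<^sup>2) * (\<integral>\<^sup>+ t. ennreal (\<bar>h t\<bar>\<^sup>2) \<partial>lebesgue_on {0..1}) +
     ennreal (b\<^sup>2) * (\<integral>\<^sup>+ t. flux_action K w (\<mu> t) (V t) \<partial>lebesgue_on {0..1})"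

end

theory Submission
  imports Defs
begin

text \<open>
  Suppose that an optimal curve has a density with a zero at many times. The proof shows that such a
  curve would have to pause on a whole interval of time, which is never optimal.

  At an interior time \<open>t\<close> with \<open>\<mu>\<^sub>t(x) = 0\<close> the nonnegative function \<open>s \<mapsto> \<mu>\<^sub>s(x)\<close> has a minimum, so its
  derivative vanishes there. Since \<open>\<theta>\<close> vanishes on every edge at \<open>x\<close>, finite action forbids any flux
  through these edges. The continuity equation therefore leaves \<open>h\<^sub>t p(x) = 0\<close>, that is \<open>h\<^sub>t = 0\<close>
  (\<open>source_vanishes_at_zeros\<close>). As \<open>h\<close> is the derivative of the total mass \<open>\<Sum>\<^sub>x \<mu>\<^sub>t(x) \<varpi>(x)\<close>, all these times
  are critical points of the mass.

  Now add \<open>\<epsilon> G(t) p\<close> to the curve and \<open>\<epsilon> G'(t)\<close> to the source, where \<open>G\<close> is a nonnegative tent function.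
  The flux is unchanged and the densities increase, so the transport action can only decrease, by the
  monotonicity of \<open>\<theta>\<close>. Optimality forces the first-order change \<open>2 a\<^sup>2 \<epsilon> \<integral> h G'\<close> of the source cost to be
  nonnegative, which says that the mass is a concave function of time (\<open>optimal_mass_concave\<close>).
  A concave function with critical points \<open>s < t\<close> is maximal at both, hence constant between them.
  On \<open>[s, t]\<close> the first-order change of the source cost is thus zero, and so is the first-order gain in action.
  But \<open>\<theta>\<close> is homogeneous of degree one, and \<open>\<mu> + \<epsilon> G p\<close> dominates \<open>(1 + \<epsilon> \<kappa> G) \<mu>\<close> for some constant \<open>\<kappa> > 0\<close>,
  so this gain is at least a positive multiple of the action itself. Hence there is no flux on \<open>(s, t)\<close>
  (\<open>optimal_no_flux_on_affine_mass\<close>), and no source either.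

  Finally, running through \<open>[0, c]\<close> and \<open>[c, 1]\<close> at two different speeds shows that an optimal curve spends
  its energy at a constant rate (\<open>optimal_constant_speed\<close>). A pause on \<open>(s, t)\<close> then makes the total energy zero,
  and a curve of zero energy is constant (\<open>zero_energy_constant\<close>), contradicting \<open>\<mu>\<^sub>0 \<noteq> \<mu>\<^sub>1\<close>.

  All these variations produce fluxes, while the metric is an infimum over potentials. The bridge is
  \<open>W_squared_le_E_Quad\<close>: for positive densities the flux of least action with a given divergence is
  \<open>\<theta> \<nabla>\<psi>\<close>, where \<open>\<psi>\<close> solves a Poisson equation; Cramer's rule makes \<open>\<psi>\<close> measurable in time. A general curve is
  first lifted to positive densities by adding \<open>\<kappa> t (1 - t) p\<close>, and then \<open>\<kappa>\<close> tends to zero. The same comparison shows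
  that the metric is finite (\<open>W_squared_finite\<close>).
\<close>

section \<open>Absolutely continuous functions of one variable\<close>

lemma AE_lebesgue_on_negligible:
  assumes "negligible N" "S \<in> sets lebesgue"
  shows "AE t in lebesgue_on S. t \<notin> N"
proof -
  have "AE t in lebesgue. t \<notin> N" using assms(1) by (intro AE_not_in) (simp add: negligible_iff_null_sets)
  then show ?thesis using assms(2) by (auto simp: AE_restrict_space_iff elim: eventually_mono)
qed

lemma AE_lebesgue_on_iff_negligible:
  assumes "S \<in> sets lebesgue"
  shows "(AE t in lebesgue_on S. P t) \<longleftrightarrow> (\<exists>N. negligible N \<and> (\<forall>t\<in>S - N. P t))"
proof
  assume "AE t in lebesgue_on S. P t"
  then have "AE t in lebesgue. t \<in> S \<longrightarrow> P t" using assms by (simp add: AE_restrict_space_iff)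
  then obtain N where "N \<in> null_sets lebesgue" "{t\<in>space lebesgue. \<not> (t \<in> S \<longrightarrow> P t)} \<subseteq> N"
    unfolding eventually_ae_filter by blast
  then show "\<exists>N. negligible N \<and> (\<forall>t\<in>S - N. P t)"
    by (auto simp: negligible_iff_null_sets intro!: exI[of _ N])
next
  assume "\<exists>N. negligible N \<and> (\<forall>t\<in>S - N. P t)"
  then obtain N where N: "negligible N" "\<forall>t\<in>S - N. P t" by blast
  show "AE t in lebesgue_on S. P t"
    using AE_lebesgue_on_negligible[OF N(1) assms] AE_space by eventually_elim (use N(2) in auto)
qed

lemma division_length_eq_measure:
  fixes S :: "real set"
  assumes "\<D> division_of S"
  shows "(\<Sum>I\<in>\<D>. Sup I - Inf I) = measure lebesgue S"
proof -
  have K: "\<exists>u v. u \<le> v \<and> I = {u..v}" if "I \<in> \<D>" for I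
    using division_ofD(3,4)[OF assms that] by (metis atLeastatMost_empty_iff box_real(2))
  have "((\<lambda>x. 1::real) has_integral (Sup I - Inf I)) I" if I: "I \<in> \<D>" for I
  proof -
    obtain u v where uv: "u \<le> v" "I = {u..v}" using K[OF I] by auto
    show ?thesis using has_integral_const_real[of "1::real" u v] uv by simp
  qed
  then have "((\<lambda>x. 1::real) has_integral (\<Sum>I\<in>\<D>. Sup I - Inf I)) S"
    by (intro has_integral_combine_division[OF assms])
  moreover have "S \<in> lmeasurable"
    using assms by (rule lmeasurable_division)
  ultimately show ?thesis
    by (simp add: lmeasure_integral integral_unique)
qed

text \<open>
  The fundamental theorem of calculus for absolutely continuous functions, proved for the gauge integral.
  Off the null set the gauge is given by differentiability. Over the null set the intervals of a fine tagged division
  lie in an open set of small measure, so absolute continuity makes the increments of the function there small.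
\<close>

lemma abs_continuous_has_integral:
  assumes ac: "abs_continuous_on_interval l r f"
    and cd: "l \<le> c" "c \<le> d" "d \<le> r"
    and N: "negligible N"
    and der: "\<And>t. t \<in> {c..d} - N \<Longrightarrow> (f has_real_derivative f' t) (at t within {l..r})"
  shows "(f' has_integral f d - f c) {c..d}"
proof -
  define F where "F = (\<lambda>t. if t \<in> N then 0 else f' t)"
  have "(F has_integral f d - f c) {c..d}"
    unfolding has_integral_real
  proof (intro allI impI)
    fix e :: real assume e: "0 < e"
    \<comment> \<open>Half of the error is allowed off the null set; the summand 1 covers the case of an empty interval.\<close>
    define e1 where "e1 = e / 2 / (d - c + 1)"
    have e1: "0 < e1" "e1 * (d - c) < e/2"
      using e cd by (auto simp: e1_def field_simps)
    obtain \<delta> where \<delta>: "\<delta> > 0" and ac': "\<And>\<D> S. \<D> division_of S \<Longrightarrow> S \<subseteq> {l..r} \<Longrightarrow>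
        (\<Sum>I\<in>\<D>. Sup I - Inf I) < \<delta> \<Longrightarrow> (\<Sum>I\<in>\<D>. \<bar>f (Sup I) - f (Inf I)\<bar>) < e/2"
      using ac e unfolding abs_continuous_on_interval_def by (meson half_gt_zero)
    obtain U where U: "open U" "N \<subseteq> U" "U \<in> lmeasurable" "measure lebesgue U < \<delta>"
    proof -
      have NL: "N \<in> lmeasurable" "measure lebesgue N = 0"
        using N by (auto simp: negligible_imp_measurable negligible_imp_measure0)
      obtain U where "open U" "N \<subseteq> U" "(U - N) \<in> lmeasurable" "emeasure lebesgue (U - N) < ennreal \<delta>"
        using sets_lebesgue_outer_open[OF fmeasurableD[OF NL(1)] \<delta>] by metis
      moreover from this NL have "U \<in> lmeasurable"
        by (metis Diff_partition fmeasurable.Un)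
      moreover from calculation have "measure lebesgue U < \<delta>"
      proof -
        have "measure lebesgue U = measure lebesgue (U - N)"
          using measure_Diff_null_set[of U lebesgue N] \<open>U \<in> lmeasurable\<close> N negligible_iff_null_sets
          by (metis fmeasurableD measure_Diff_null_set)
        then show ?thesis
          using \<open>emeasure lebesgue (U - N) < ennreal \<delta>\<close> \<open>(U - N) \<in> lmeasurable\<close> \<delta>
          by (simp add: emeasure_eq_measure2 ennreal_less_iff)
      qed
      ultimately show ?thesis using that by blast
    qed
    have "\<exists>\<eta>>0. t \<in> {c..d} - N \<longrightarrow> (\<forall>y\<in>{l..r}. \<bar>y - t\<bar> < \<eta> \<longrightarrow> \<bar>f y - f t - f' t * (y - t)\<bar> \<le> e1 * \<bar>y - t\<bar>)" for t
    proof (cases "t \<in> {c..d} - N")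
      case True
      then show ?thesis
        using der[OF True] e1 unfolding has_field_derivative_def has_derivative_within_alt by auto
    next
      case False then show ?thesis by (metis zero_less_one)
    qed
    then obtain \<eta> where \<eta>: "\<And>t. \<eta> t > 0"
      "\<And>t y. t \<in> {c..d} - N \<Longrightarrow> y\<in>{l..r} \<Longrightarrow> \<bar>y - t\<bar> < \<eta> t \<Longrightarrow> \<bar>f y - f t - f' t * (y - t)\<bar> \<le> e1 * \<bar>y - t\<bar>"
      by metis
    \<comment> \<open>Intervals tagged in the null set must stay in its small neighbourhood.\<close>
    define \<gamma> where "\<gamma> = (\<lambda>t. if t \<in> N then U else ball t (\<eta> t))"
    have "gauge \<gamma>" unfolding gauge_def \<gamma>_def using U \<eta> by auto
    moreover have "norm (sum (\<lambda>(x,k). measure lborel k *\<^sub>R F x) p - (f d - f c)) < e"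
      if p: "p tagged_division_of {c..d}" and fine: "\<gamma> fine p" for p
    proof -
      have finp: "finite p" using p by blast
      have pk: "\<exists>u v. u \<le> x \<and> x \<le> v \<and> k = {u..v} \<and> c \<le> u \<and> v \<le> d \<and> k \<subseteq> \<gamma> x" if "(x,k) \<in> p" for x k
      proof -
        have *: "x \<in> k" "k \<subseteq> {c..d}" "\<exists>a b. k = cbox a b" using tagged_division_ofD(2-4)[OF p that] by auto
        then obtain u v where "k = {u..v}" by auto
        moreover have "k \<subseteq> \<gamma> x" using fine that by (auto simp: fine_def)
        ultimately show ?thesis using *(1,2) by auto
      qed
      define D where "D = (\<lambda>(x::real,k). measure lborel k *\<^sub>R F x - (f (Sup k) - f (Inf k)))"
      define p1 where "p1 = {q\<in>p. fst q \<in> N}"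
      define p2 where "p2 = {q\<in>p. fst q \<notin> N}"
      have p12: "p = p1 \<union> p2" "p1 \<inter> p2 = {}" "finite p1" "finite p2"
        using finp by (auto simp: p1_def p2_def)
      have "sum (\<lambda>(x,k). measure lborel k *\<^sub>R F x) p - (f d - f c) = sum D p"
        using additive_tagged_division_1[OF cd(2) p, of f] 
        by (simp add: D_def sum_subtractf case_prod_unfold)
      also have "\<dots> = sum D p1 + sum D p2" using p12 by (metis sum.union_disjoint)
      finally have eq: "sum (\<lambda>(x,k). measure lborel k *\<^sub>R F x) p - (f d - f c) = sum D p1 + sum D p2" .
      have "\<bar>sum D p2\<bar> \<le> (\<Sum>(x,k)\<in>p2. e1 * measure lborel k)"
      proof (rule order_trans[OF sum_abs sum_mono], safe)
        fix x k assume xk: "(x,k) \<in> p2"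
        then have xkp: "(x,k) \<in> p" and xN: "x \<notin> N" by (auto simp: p2_def)
        obtain u v where uv: "u \<le> x" "x \<le> v" "k = {u..v}" "c \<le> u" "v \<le> d" "k \<subseteq> ball x (\<eta> x)"
          using pk[OF xkp] xN by (auto simp: \<gamma>_def)
        have "u \<in> k" "v \<in> k" using uv by simp_all
        then have "u \<in> ball x (\<eta> x)" "v \<in> ball x (\<eta> x)" using uv(6) by blast+
        then have "\<bar>u - x\<bar> < \<eta> x" "\<bar>v - x\<bar> < \<eta> x" by (auto simp: dist_real_def)
        moreover have "u \<in> {l..r}" "v \<in> {l..r}" "x \<in> {c..d} - N" using uv cd xN by auto
        ultimately have "\<bar>f u - f x - f' x * (u - x)\<bar> \<le> e1 * \<bar>u - x\<bar>" "\<bar>f v - f x - f' x * (v - x)\<bar> \<le> e1 * \<bar>v - x\<bar>"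
          using \<eta>(2) by blast+
        then have "\<bar>f u - f x - f' x * (u - x)\<bar> + \<bar>f v - f x - f' x * (v - x)\<bar> \<le> e1 * (v - u)"
          using uv by (simp add: algebra_simps)
        moreover have "(v - u) * f' x - (f v - f u) = (f u - f x - f' x * (u - x)) - (f v - f x - f' x * (v - x))"
          by (simp add: algebra_simps)
        ultimately have "\<bar>(v - u) * f' x - (f v - f u)\<bar> \<le> e1 * (v - u)" by linarith
        then show "\<bar>D (x,k)\<bar> \<le> e1 * measure lborel k" using uv xN by (simp add: D_def F_def)
      qed
      also have "\<dots> \<le> (\<Sum>(x,k)\<in>p. e1 * measure lborel k)"
        using finp e1 by (intro sum_mono2) (auto simp: p2_def)
      also have "\<dots> = e1 * (d - c)"
        using additive_content_tagged_division[of p c d] p cd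
        by (simp add: case_prod_unfold flip: sum_distrib_left)
      finally have b2: "\<bar>sum D p2\<bar> < e/2" using e1 by linarith
      have tp1: "p1 tagged_partial_division_of {c..d}"
        using p tagged_partial_division_subset[of p "{c..d}" p1] by (auto simp: p1_def tagged_division_of_def)
      have div1: "snd ` p1 division_of \<Union>(snd ` p1)"
        using partial_division_of_tagged_division[OF tp1] .
      have subU: "\<Union>(snd ` p1) \<subseteq> U" 
      proof
        fix y assume "y \<in> \<Union>(snd ` p1)"
        then obtain x k where xk: "(x,k) \<in> p" "x \<in> N" "y \<in> k" by (auto simp: p1_def)
        then show "y \<in> U" using pk[OF xk(1)] by (auto simp: \<gamma>_def)
      qed
      have sublr: "\<Union>(snd ` p1) \<subseteq> {l..r}"
      proof
        fix y assume "y \<in> \<Union>(snd ` p1)"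
        then obtain x k where xk: "(x,k) \<in> p1" "y \<in> k" by auto
        then show "y \<in> {l..r}" using tagged_partial_division_ofD(3)[OF tp1 xk(1)] cd by auto
      qed
      have "(\<Sum>I\<in>snd ` p1. Sup I - Inf I) \<le> measure lebesgue U"
        unfolding division_length_eq_measure[OF div1]
        using U subU fmeasurableD[OF lmeasurable_division[OF div1]] by (intro measure_mono_fmeasurable) auto
      with U have "(\<Sum>I\<in>snd ` p1. Sup I - Inf I) < \<delta>" by linarith
      from ac'[OF div1 sublr this] have "(\<Sum>I\<in>snd ` p1. \<bar>f (Sup I) - f (Inf I)\<bar>) < e/2" .
      moreover have "(\<Sum>(x,k)\<in>p1. \<bar>f (Sup k) - f (Inf k)\<bar>) = (\<Sum>I\<in>snd ` p1. \<bar>f (Sup I) - f (Inf I)\<bar>)"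
      proof -
        \<comment> \<open>Passing from tagged intervals to intervals needs a summand that vanishes on degenerate ones.\<close>
        let ?v = "\<lambda>I. if I = {} then 0 else \<bar>f (Sup I) - f (Inf I)\<bar>"
        have ne: "k \<noteq> {}" if "(x,k) \<in> p1" for x k
          using tagged_partial_division_ofD(2)[OF tp1 that] by auto
        have "(\<Sum>(x,k)\<in>p1. ?v k) = (\<Sum>I\<in>snd ` p1. ?v I)"
        proof (rule sum.over_tagged_division_lemma[OF tagged_partial_division_of_Union_self[OF tp1]])
          fix u v :: real assume "box u v = {}"
          then show "?v (cbox u v) = 0"
            by (cases "u = v") auto
        qed
        moreover have "(\<Sum>(x,k)\<in>p1. ?v k) = (\<Sum>(x,k)\<in>p1. \<bar>f (Sup k) - f (Inf k)\<bar>)"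
          using ne by (intro sum.cong) auto
        moreover have "(\<Sum>I\<in>snd ` p1. ?v I) = (\<Sum>I\<in>snd ` p1. \<bar>f (Sup I) - f (Inf I)\<bar>)"
          using ne by (intro sum.cong) auto
        ultimately show ?thesis by simp
      qed
      moreover have "\<bar>sum D p1\<bar> \<le> (\<Sum>(x,k)\<in>p1. \<bar>f (Sup k) - f (Inf k)\<bar>)"
        by (rule order_trans[OF sum_abs sum_mono]) (auto simp: D_def F_def p1_def)
      ultimately have "\<bar>sum D p1\<bar> < e/2" by linarith
      with b2 eq show ?thesis by simp
    qed
    ultimately show "\<exists>\<gamma>. gauge \<gamma> \<and> (\<forall>\<D>. \<D> tagged_division_of {c..d} \<and> \<gamma> fine \<D> \<longrightarrow>
        norm (sum (\<lambda>(x,k). measure lborel k *\<^sub>R F x) \<D> - (f d - f c)) < e)"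
      by (intro exI[of _ \<gamma>] conjI allI impI) simp_all
  qed
  then show ?thesis
    using has_integral_spike[OF N, of "{c..d}" f' F] by (simp add: F_def)
qed

lemma abs_continuous_lipschitz:
  assumes "\<And>x y. x \<in> {l..r} \<Longrightarrow> y \<in> {l..r} \<Longrightarrow> \<bar>f x - f y\<bar> \<le> L * \<bar>x - y\<bar>"
  shows "abs_continuous_on_interval l r f"
  unfolding abs_continuous_on_interval_def
proof (intro allI impI)
  fix e :: real assume e: "0 < e"
  define M where "M = max L 1"
  have M: "M > 0" "L \<le> M" by (auto simp: M_def)
  show "\<exists>\<delta>>0. \<forall>\<D> S. \<D> division_of S \<longrightarrow> S \<subseteq> {l..r} \<longrightarrow> (\<Sum>I\<in>\<D>. Sup I - Inf I) < \<delta> \<longrightarrow>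
        (\<Sum>I\<in>\<D>. \<bar>f (Sup I) - f (Inf I)\<bar>) < e"
  proof (intro exI[of _ "e / M"] conjI allI impI)
    show "e / M > 0" using e M by simp
    fix \<D> :: "real set set" and S assume D: "\<D> division_of S" "S \<subseteq> {l..r}" "(\<Sum>I\<in>\<D>. Sup I - Inf I) < e / M"
    have "(\<Sum>I\<in>\<D>. \<bar>f (Sup I) - f (Inf I)\<bar>) \<le> (\<Sum>I\<in>\<D>. M * (Sup I - Inf I))"
    proof (rule sum_mono)
      fix I assume I: "I \<in> \<D>"
      have "I \<subseteq> {l..r}" "I \<noteq> {}" "\<exists>u v. I = cbox u v" using division_ofD(2-4)[OF D(1) I] D(2) by auto
      then obtain u v where uv: "I = {u..v}" "u \<le> v" "u \<in> {l..r}" "v \<in> {l..r}" by auto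
      have "\<bar>f v - f u\<bar> \<le> L * (v - u)" using assms[of v u] uv by auto
      also have "\<dots> \<le> M * (v - u)" using M uv by (intro mult_right_mono) auto
      finally show "\<bar>f (Sup I) - f (Inf I)\<bar> \<le> M * (Sup I - Inf I)" using uv by simp
    qed
    also have "\<dots> < e" using D(3) M by (simp add: sum_distrib_left[symmetric] pos_less_divide_eq mult.commute)
    finally show "(\<Sum>I\<in>\<D>. \<bar>f (Sup I) - f (Inf I)\<bar>) < e" .
  qed
qed

lemma abs_continuous_bounded_derivative:
  assumes "\<And>t. t \<in> {l..r} \<Longrightarrow> (f has_real_derivative f' t) (at t within {l..r})"
    and "\<And>t. t \<in> {l..r} \<Longrightarrow> \<bar>f' t\<bar> \<le> L"
  shows "abs_continuous_on_interval l r f"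
proof (rule abs_continuous_lipschitz)
  fix x y assume "x \<in> {l..r}" "y \<in> {l..r}"
  then show "\<bar>f x - f y\<bar> \<le> L * \<bar>x - y\<bar>"
    using field_differentiable_bound[of "{l..r}" f f' L x y] assms by simp
qed

lemma abs_continuous_add:
  assumes "abs_continuous_on_interval l r f" "abs_continuous_on_interval l r g"
  shows "abs_continuous_on_interval l r (\<lambda>t. f t + g t)"
  unfolding abs_continuous_on_interval_def
proof (intro allI impI)
  fix e :: real assume e: "0 < e"
  obtain d1 where d1: "d1 > 0" "\<And>\<D> S. \<D> division_of S \<Longrightarrow> S \<subseteq> {l..r} \<Longrightarrow> (\<Sum>I\<in>\<D>. Sup I - Inf I) < d1 \<Longrightarrow>
        (\<Sum>I\<in>\<D>. \<bar>f (Sup I) - f (Inf I)\<bar>) < e/2"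
    using assms(1) e unfolding abs_continuous_on_interval_def by (meson half_gt_zero)
  obtain d2 where d2: "d2 > 0" "\<And>\<D> S. \<D> division_of S \<Longrightarrow> S \<subseteq> {l..r} \<Longrightarrow> (\<Sum>I\<in>\<D>. Sup I - Inf I) < d2 \<Longrightarrow>
        (\<Sum>I\<in>\<D>. \<bar>g (Sup I) - g (Inf I)\<bar>) < e/2"
    using assms(2) e unfolding abs_continuous_on_interval_def by (meson half_gt_zero)
  show "\<exists>\<delta>>0. \<forall>\<D> S. \<D> division_of S \<longrightarrow> S \<subseteq> {l..r} \<longrightarrow> (\<Sum>I\<in>\<D>. Sup I - Inf I) < \<delta> \<longrightarrow>
        (\<Sum>I\<in>\<D>. \<bar>f (Sup I) + g (Sup I) - (f (Inf I) + g (Inf I))\<bar>) < e"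
  proof (intro exI[of _ "min d1 d2"] conjI allI impI)
    fix \<D> :: "real set set" and S assume D: "\<D> division_of S" "S \<subseteq> {l..r}" "(\<Sum>I\<in>\<D>. Sup I - Inf I) < min d1 d2"
    have "(\<Sum>I\<in>\<D>. \<bar>f (Sup I) + g (Sup I) - (f (Inf I) + g (Inf I))\<bar>)
        \<le> (\<Sum>I\<in>\<D>. \<bar>f (Sup I) - f (Inf I)\<bar> + \<bar>g (Sup I) - g (Inf I)\<bar>)"
      by (intro sum_mono) linarith
    also have "\<dots> < e" using d1(2)[OF D(1,2)] d2(2)[OF D(1,2)] D(3) by (simp add: sum.distrib)
    finally show "(\<Sum>I\<in>\<D>. \<bar>f (Sup I) + g (Sup I) - (f (Inf I) + g (Inf I))\<bar>) < e" .
  qed (use d1 d2 in auto)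
qed

lemma abs_continuous_cmult:
  assumes "abs_continuous_on_interval l r f"
  shows "abs_continuous_on_interval l r (\<lambda>t. c * f t)"
proof (cases "c = 0")
  case True
  then show ?thesis using abs_continuous_lipschitz[of l r "\<lambda>t. 0" 0] by simp
next
  case False
  show ?thesis
    unfolding abs_continuous_on_interval_def
  proof (intro allI impI)
    fix e :: real assume "0 < e"
    then have "0 < e / \<bar>c\<bar>" using False by simp
    then obtain d where "d > 0" "\<And>\<D> S. \<D> division_of S \<Longrightarrow> S \<subseteq> {l..r} \<Longrightarrow> (\<Sum>I\<in>\<D>. Sup I - Inf I) < d \<Longrightarrow>
        (\<Sum>I\<in>\<D>. \<bar>f (Sup I) - f (Inf I)\<bar>) < e / \<bar>c\<bar>"
      using assms unfolding abs_continuous_on_interval_def by meson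
    then show "\<exists>\<delta>>0. \<forall>\<D> S. \<D> division_of S \<longrightarrow> S \<subseteq> {l..r} \<longrightarrow> (\<Sum>I\<in>\<D>. Sup I - Inf I) < \<delta> \<longrightarrow>
        (\<Sum>I\<in>\<D>. \<bar>c * f (Sup I) - c * f (Inf I)\<bar>) < e"
      using False by (intro exI[of _ d])
        (auto simp: right_diff_distrib[symmetric] abs_mult sum_distrib_left[symmetric] pos_less_divide_eq mult.commute)
  qed
qed

lemma abs_continuous_imp_continuous_on:
  assumes "abs_continuous_on_interval l r f"
  shows "continuous_on {l..r} f"
  unfolding continuous_on_iff
proof (intro ballI allI impI)
  fix x e :: real assume x: "x \<in> {l..r}" and e: "0 < e"
  obtain d where d: "d > 0" "\<And>\<D> S. \<D> division_of S \<Longrightarrow> S \<subseteq> {l..r} \<Longrightarrow> (\<Sum>I\<in>\<D>. Sup I - Inf I) < d \<Longrightarrow>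
        (\<Sum>I\<in>\<D>. \<bar>f (Sup I) - f (Inf I)\<bar>) < e"
    using assms e unfolding abs_continuous_on_interval_def by meson
  show "\<exists>d>0. \<forall>x'\<in>{l..r}. dist x' x < d \<longrightarrow> dist (f x') (f x) < e"
  proof (intro exI[of _ d] conjI ballI impI)
    fix y assume y: "y \<in> {l..r}" "dist y x < d"
    have "{{min x y..max x y}} division_of {min x y..max x y}"
      using division_of_self[of "min x y" "max x y"] by auto
    from d(2)[OF this] x y have "\<bar>f (max x y) - f (min x y)\<bar> < e" by (auto simp: dist_real_def)
    then show "dist (f y) (f x) < e" by (auto simp: dist_real_def max_def min_def split: if_splits)
  qed (use d in auto)
qed

text \<open>
  An injective monotone change of time maps a division to a division, and a Lipschitz one stretches its total length
  by a bounded factor.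
\<close>

lemma abs_continuous_compose_strict_mono:
  assumes f: "abs_continuous_on_interval l' r' f"
    and mono: "strict_mono_on {l..r} \<sigma>"
    and ran: "\<sigma> ` {l..r} \<subseteq> {l'..r'}"
    and lip: "\<And>x y. x \<in> {l..r} \<Longrightarrow> y \<in> {l..r} \<Longrightarrow> \<bar>\<sigma> x - \<sigma> y\<bar> \<le> L * \<bar>x - y\<bar>"
  shows "abs_continuous_on_interval l r (\<lambda>t. f (\<sigma> t))"
  unfolding abs_continuous_on_interval_def
proof (intro allI impI)
  fix e :: real assume e: "0 < e"
  have cont: "continuous_on {l..r} \<sigma>" using abs_continuous_imp_continuous_on abs_continuous_lipschitz lip by blast
  have inj: "inj_on \<sigma> {l..r}" using mono by (rule strict_mono_on_imp_inj_on)
  obtain d where d: "d > 0" "\<And>\<D> S. \<D> division_of S \<Longrightarrow> S \<subseteq> {l'..r'} \<Longrightarrow> (\<Sum>I\<in>\<D>. Sup I - Inf I) < d \<Longrightarrow>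
        (\<Sum>I\<in>\<D>. \<bar>f (Sup I) - f (Inf I)\<bar>) < e"
    using f e unfolding abs_continuous_on_interval_def by meson
  define M where "M = max L 1"
  have M: "M > 0" "L \<le> M" by (auto simp: M_def)
  have img: "\<sigma> ` {u..v} = {\<sigma> u..\<sigma> v}" "\<sigma> u \<le> \<sigma> v" if uv: "l \<le> u" "u \<le> v" "v \<le> r" for u v
  proof -
    have le: "\<sigma> x \<le> \<sigma> y" if "x \<in> {l..r}" "y \<in> {l..r}" "x \<le> y" for x y
      using strict_mono_onD[OF mono that(1,2)] that(3) by (cases "x = y") auto
    show "\<sigma> u \<le> \<sigma> v" using le uv by auto
    show "\<sigma> ` {u..v} = {\<sigma> u..\<sigma> v}"
    proof
      show "\<sigma> ` {u..v} \<subseteq> {\<sigma> u..\<sigma> v}" using le uv by auto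
      show "{\<sigma> u..\<sigma> v} \<subseteq> \<sigma> ` {u..v}"
        using IVT'[of \<sigma> u _ v] continuous_on_subset[OF cont, of "{u..v}"] uv by force
    qed
  qed
  show "\<exists>\<delta>>0. \<forall>\<D> S. \<D> division_of S \<longrightarrow> S \<subseteq> {l..r} \<longrightarrow> (\<Sum>I\<in>\<D>. Sup I - Inf I) < \<delta> \<longrightarrow>
        (\<Sum>I\<in>\<D>. \<bar>f (\<sigma> (Sup I)) - f (\<sigma> (Inf I))\<bar>) < e"
  proof (intro exI[of _ "d / M"] conjI allI impI)
    fix \<D> :: "real set set" and S assume D: "\<D> division_of S" "S \<subseteq> {l..r}" "(\<Sum>I\<in>\<D>. Sup I - Inf I) < d / M"
    have K: "\<exists>u v. l \<le> u \<and> u \<le> v \<and> v \<le> r \<and> I = {u..v}" if I: "I \<in> \<D>" for I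
    proof -
      have "I \<subseteq> {l..r}" "I \<noteq> {}" "\<exists>u v. I = cbox u v" using division_ofD(2-4)[OF D(1) I] D(2) by auto
      then show ?thesis by auto
    qed
    let ?D = "(\<lambda>I. \<sigma> ` I) ` \<D>"
    have injD: "inj_on (\<lambda>I. \<sigma> ` I) \<D>"
    proof (rule inj_onI)
      fix I J assume "I \<in> \<D>" "J \<in> \<D>" "\<sigma> ` I = \<sigma> ` J"
      moreover from this have "I \<subseteq> {l..r}" "J \<subseteq> {l..r}" using D division_ofD(2)[OF D(1)] by blast+
      ultimately show "I = J" using inj inj_on_image_eq_iff by metis
    qed
    have supinf: "Sup (\<sigma> ` I) = \<sigma> (Sup I)" "Inf (\<sigma> ` I) = \<sigma> (Inf I)" if I: "I \<in> \<D>" for I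
    proof -
      obtain u v where uv: "l \<le> u" "u \<le> v" "v \<le> r" "I = {u..v}" using K[OF I] by blast
      show "Sup (\<sigma> ` I) = \<sigma> (Sup I)" "Inf (\<sigma> ` I) = \<sigma> (Inf I)"
        using img[OF uv(1-3)] uv by simp_all
    qed
    have "?D division_of \<sigma> ` S"
    proof (rule division_ofI)
      show "finite ?D" using D(1) by (simp add: division_of_def)
      fix J assume "J \<in> ?D"
      then obtain I where I: "I \<in> \<D>" "J = \<sigma> ` I" by blast
      obtain u v where uv: "l \<le> u" "u \<le> v" "v \<le> r" "I = {u..v}" using K[OF I(1)] by blast
      show "J \<subseteq> \<sigma> ` S" "J \<noteq> {}" using division_ofD(2,3)[OF D(1) I(1)] I by auto
      show "\<exists>a b. J = cbox a b" using img[OF uv(1-3)] uv I by (metis box_real(2))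
      fix J' assume "J' \<in> ?D" "J \<noteq> J'"
      then obtain I' where I': "I' \<in> \<D>" "J' = \<sigma> ` I'" "I \<noteq> I'" using I by blast
      obtain u' v' where uv': "l \<le> u'" "u' \<le> v'" "v' \<le> r" "I' = {u'..v'}" using K[OF I'(1)] by blast
      have disj: "{u<..<v} \<inter> {u'<..<v'} = {}"
        using division_ofD(5)[OF D(1) I(1) I'(1,3)] uv uv' by simp
      show "interior J \<inter> interior J' = {}"
      proof (rule ccontr)
        assume "interior J \<inter> interior J' \<noteq> {}"
        then obtain y where "y \<in> interior J \<inter> interior J'" by blast
        moreover have "interior J = {\<sigma> u<..<\<sigma> v}" "interior J' = {\<sigma> u'<..<\<sigma> v'}"
          using img[OF uv(1-3)] img[OF uv'(1-3)] uv uv' I I' by simp_all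
        ultimately have y: "\<sigma> u < y" "y < \<sigma> v" "\<sigma> u' < y" "y < \<sigma> v'" by auto
        then have "y \<in> \<sigma> ` {u..v}" "y \<in> \<sigma> ` {u'..v'}"
          using img[OF uv(1-3)] img[OF uv'(1-3)] by auto
        then obtain z z' where z: "z \<in> {u..v}" "y = \<sigma> z" "z' \<in> {u'..v'}" "y = \<sigma> z'" by blast
        then have "z = z'" using inj uv uv' by (auto simp: inj_on_def)
        moreover have "z \<noteq> u" "z \<noteq> v" "z' \<noteq> u'" "z' \<noteq> v'" using y z by auto
        ultimately have "z \<in> {u<..<v} \<inter> {u'<..<v'}" using z by auto
        then show False using disj by blast
      qed
    next
      show "\<Union>?D = \<sigma> ` S" using division_ofD(6)[OF D(1)] by blast
    qed
    moreover have "\<sigma> ` S \<subseteq> {l'..r'}" using D(2) ran by blast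
    moreover have "(\<Sum>I\<in>?D. Sup I - Inf I) < d"
    proof -
      have "(\<Sum>I\<in>?D. Sup I - Inf I) = (\<Sum>I\<in>\<D>. \<sigma> (Sup I) - \<sigma> (Inf I))"
        using injD supinf by (simp add: sum.reindex)
      also have "\<dots> \<le> (\<Sum>I\<in>\<D>. M * (Sup I - Inf I))"
      proof (rule sum_mono)
        fix I assume "I \<in> \<D>"
        then obtain u v where uv: "l \<le> u" "u \<le> v" "v \<le> r" "I = {u..v}" using K by blast
        have "\<sigma> v - \<sigma> u \<le> L * (v - u)" using lip[of v u] uv by auto
        also have "\<dots> \<le> M * (v - u)" using M uv by (intro mult_right_mono) auto
        finally show "\<sigma> (Sup I) - \<sigma> (Inf I) \<le> M * (Sup I - Inf I)" using uv by simp
      qed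
      also have "\<dots> < d" using D(3) M by (simp add: sum_distrib_left[symmetric] pos_less_divide_eq mult.commute)
      finally show ?thesis .
    qed
    ultimately have "(\<Sum>I\<in>?D. \<bar>f (Sup I) - f (Inf I)\<bar>) < e" using d(2) by blast
    then show "(\<Sum>I\<in>\<D>. \<bar>f (\<sigma> (Sup I)) - f (\<sigma> (Inf I))\<bar>) < e"
      using injD supinf by (simp add: sum.reindex)
  qed (use d M in auto)
qed

lemma abs_continuous_measurable:
  assumes "abs_continuous_on_interval 0 1 f"
  shows "f \<in> borel_measurable (lebesgue_on {0..1})"
  using abs_continuous_imp_continuous_on[OF assms] by (intro continuous_imp_measurable_on_sets_lebesgue) auto

section \<open>The logarithmic mean\<close>

lemma log_mean_formula:
  assumes "0 \<le> u" "0 \<le> v"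
  shows "log_mean u v = (if u = v then u else if u = 0 \<or> v = 0 then 0 else (u - v) / (ln u - ln v))"
  using assms log_mean_neq[of u v] by auto

lemma log_mean_commute: "0 \<le> u \<Longrightarrow> 0 \<le> v \<Longrightarrow> log_mean u v = log_mean v u"
  by (simp add: log_mean_formula) (metis minus_diff_eq minus_divide_divide)

lemma log_mean_scale:
  assumes "0 \<le> c" "0 \<le> u" "0 \<le> v"
  shows "log_mean (c * u) (c * v) = c * log_mean u v"
proof (cases "c = 0 \<or> u = 0 \<or> v = 0")
  case True then show ?thesis using assms by auto
next
  case False
  then show ?thesis using assms
    by (auto simp: log_mean_formula ln_mult right_diff_distrib[symmetric])
qed

lemma log_mean_mono:
  assumes "0 \<le> u" "0 \<le> v" "u \<le> u'" "v \<le> v'"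
  shows "log_mean u v \<le> log_mean u' v'"
proof -
  have int: "(\<lambda>\<xi>. u powr \<xi> * v powr (1 - \<xi>)) integrable_on {0..1}" if "u \<ge> 0" "v \<ge> 0" for u v :: real
  proof (cases "u = 0 \<or> v = 0")
    case False
    then show ?thesis using that by (intro integrable_continuous_interval continuous_intros) auto
  next
    case True then show ?thesis by auto
  qed
  show ?thesis unfolding log_mean_def
    using assms by (intro integral_le int mult_mono powr_mono2) auto
qed

lemma log_mean_ge_min: "0 \<le> u \<Longrightarrow> 0 \<le> v \<Longrightarrow> min u v \<le> log_mean u v"
  using log_mean_mono[of "min u v" "min u v" u v] by auto

lemma log_mean_nonneg: "0 \<le> u \<Longrightarrow> 0 \<le> v \<Longrightarrow> 0 \<le> log_mean u v"
  using log_mean_ge_min[of u v] by linarith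

lemma log_mean_pos: "0 < u \<Longrightarrow> 0 < v \<Longrightarrow> 0 < log_mean u v"
  using log_mean_ge_min[of u v] by linarith

text \<open>
  The closed form of the logarithmic mean is visibly measurable, whereas the defining integral is not.
\<close>

lemma measurable_log_mean:
  assumes [measurable]: "f \<in> borel_measurable M" "g \<in> borel_measurable M"
    and "\<And>x. x \<in> space M \<Longrightarrow> 0 \<le> f x" "\<And>x. x \<in> space M \<Longrightarrow> 0 \<le> g x"
  shows "(\<lambda>x. log_mean (f x) (g x)) \<in> borel_measurable M"
proof (subst measurable_cong)
  show "log_mean (f x) (g x) = (if f x = g x then f x else if f x = 0 \<or> g x = 0 then 0 else (f x - g x) / (ln (f x) - ln (g x)))"
    if "x \<in> space M" for x using log_mean_formula assms(3,4) that by blast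
qed measurable

lemma log_mean_zero_or_pos: "0 \<le> s \<Longrightarrow> 0 \<le> t \<Longrightarrow> log_mean s t = 0 \<or> 0 < log_mean s t"
  using log_mean_nonneg[of s t] by linarith

section \<open>The Poisson equation on an irreducible chain\<close>

text \<open>
  Irreducibility is used only in this form: a property that passes along the edges of the kernel holds
  everywhere as soon as it holds at one point.
\<close>

lemma irreducible_kernel_propagates:
  assumes K: "markov_kernel K" "irreducible_kernel K"
    and step: "\<And>x y. P x \<Longrightarrow> 0 < K x y \<Longrightarrow> P y" and x: "P x"
  shows "P y"
proof -
  have "0 < kernel_power K n x y \<Longrightarrow> P x \<Longrightarrow> P y" for n x y
  proof (induction n arbitrary: x)
    case 0
    then show ?case by (auto split: if_splits)
  next
    case (Suc n)
    then obtain z where z: "0 < K x z * kernel_power K n z y"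
      using sum_nonpos[of UNIV "\<lambda>z. K x z * kernel_power K n z y"] by (auto simp: not_le[symmetric])
    have "0 \<le> K x z" using K by (simp add: markov_kernel_def)
    with z have "0 < K x z" "0 < kernel_power K n z y" by (auto simp: zero_less_mult_iff)
    then show ?case using Suc.IH[of z] step[of x z] Suc.prems by blast
  qed
  then show ?thesis using K(2) x unfolding irreducible_kernel_def by blast
qed

lemma invariant_probability_pos:
  assumes K: "markov_kernel K" "irreducible_kernel K"
    and w: "invariant_probability K w" "reversible_kernel K w"
  shows "0 < w x"
proof -
  have nn: "0 \<le> w x" and sum1: "sum w UNIV = 1" for x
    using w unfolding invariant_probability_def by blast+
  have "\<exists>x. 0 < w x"
  proof (rule ccontr)
    assume "\<not> ?thesis"
    then have "sum w UNIV \<le> 0" by (intro sum_nonpos) (auto simp: not_less)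
    then show False using sum1 by simp
  qed
  then obtain x0 where "0 < w x0" by blast
  then show ?thesis
  proof (rule irreducible_kernel_propagates[OF K, where P = "\<lambda>x. 0 < w x", rotated])
    fix x y assume "0 < w x" "0 < K x y"
    then have "0 < K y x * w y" using w(2) unfolding reversible_kernel_def
      by (metis mult_pos_pos)
    then show "0 < w y" using nn[of y] by (auto simp: zero_less_mult_iff)
  qed
qed

text \<open>
  Summation by parts on the edges of a reversible chain, with \<open>q\<close> in the role of \<open>K(x,y) \<varpi>(x)\<close>.
\<close>

lemma sum_by_parts:
  fixes q :: "'a::finite \<Rightarrow> 'a \<Rightarrow> real"
  assumes "\<And>x y. q x y = q y x"
  shows "(\<Sum>x\<in>UNIV. \<Sum>y\<in>UNIV. (\<psi> y - \<psi> x) * U x y * q x y)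
    = - (\<Sum>x\<in>UNIV. \<psi> x * (\<Sum>y\<in>UNIV. (U x y - U y x) * q x y))"
proof -
  have "(\<Sum>x\<in>UNIV. \<Sum>y\<in>UNIV. \<psi> y * U x y * q x y) = (\<Sum>x\<in>UNIV. \<Sum>y\<in>UNIV. \<psi> x * U y x * q x y)"
    by (subst sum.swap) (simp add: assms[symmetric])
  then show ?thesis
    by (simp add: left_diff_distrib right_diff_distrib sum_subtractf sum_distrib_left mult.assoc)
qed

text \<open>
  The weighted graph Laplacian plus the all-ones matrix. The Laplacian is singular, because constants lie in its kernel;
  adding the all-ones matrix makes it invertible and leaves its action on vectors of zero sum unchanged.
\<close>

definition shifted_laplacian :: "('a::finite \<Rightarrow> 'a \<Rightarrow> real) \<Rightarrow> real ^ 'a ^ 'a" where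
  "shifted_laplacian c = (\<chi> x y. (if x = y then \<Sum>z\<in>UNIV. c x z else 0) - c x y + 1)"

text \<open>
  The solution of the shifted system written out by Cramer's rule. As a rational function of the weights and of
  the right-hand side it is measurable in them, so no measurable selection of potentials is needed.
\<close>

definition poisson_solution :: "('a::finite \<Rightarrow> 'a \<Rightarrow> real) \<Rightarrow> ('a \<Rightarrow> real) \<Rightarrow> 'a \<Rightarrow> real" where
  "poisson_solution c f z =
    det (\<chi> x y. if y = z then f x else shifted_laplacian c $ x $ y) / det (shifted_laplacian c)"

lemma shifted_laplacian_mult:
  "(shifted_laplacian c *v \<psi>) $ x = (\<Sum>y\<in>UNIV. (\<psi> $ x - \<psi> $ y) * c x y) + (\<Sum>y\<in>UNIV. \<psi> $ y)"
proof -
  have "(shifted_laplacian c *v \<psi>) $ x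
      = (\<Sum>y\<in>UNIV. (if x = y then (\<Sum>z\<in>UNIV. c x z) * \<psi> $ y else 0) - c x y * \<psi> $ y + \<psi> $ y)"
    unfolding matrix_vector_mult_def shifted_laplacian_def
    by (auto intro!: sum.cong simp: algebra_simps)
  also have "\<dots> = (\<Sum>z\<in>UNIV. c x z) * \<psi> $ x - (\<Sum>y\<in>UNIV. c x y * \<psi> $ y) + (\<Sum>y\<in>UNIV. \<psi> $ y)"
    by (simp add: sum.distrib sum_subtractf)
  also have "(\<Sum>z\<in>UNIV. c x z) * \<psi> $ x - (\<Sum>y\<in>UNIV. c x y * \<psi> $ y) = (\<Sum>y\<in>UNIV. (\<psi> $ x - \<psi> $ y) * c x y)"
    unfolding sum_distrib_right sum_subtractf[symmetric] by (intro sum.cong refl) (simp add: algebra_simps)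
  finally show ?thesis .
qed

text \<open>
  The quadratic form of the shifted Laplacian is the Dirichlet form plus the square of the sum. If it vanishes, then the
  vector is constant along edges, hence constant, and its sum is zero.
\<close>

lemma det_shifted_laplacian:
  assumes K: "markov_kernel K" "irreducible_kernel K"
    and c: "\<And>x y. c x y = c y x" "\<And>x y. 0 \<le> c x y" "\<And>x y. 0 < K x y \<Longrightarrow> 0 < c x y"
  shows "det (shifted_laplacian c) \<noteq> 0"
proof -
  have "\<psi> = 0" if 0: "shifted_laplacian c *v \<psi> = 0" for \<psi>
  proof -
    let ?S = "\<Sum>y\<in>UNIV. \<psi> $ y"
    have eq: "(\<Sum>y\<in>UNIV. (\<psi> $ x - \<psi> $ y) * c x y) + ?S = 0" for x
      using arg_cong[OF 0, of "\<lambda>v. v $ x"] by (simp add: shifted_laplacian_mult)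
    have D: "(\<Sum>x\<in>UNIV. \<Sum>y\<in>UNIV. (\<psi> $ y - \<psi> $ x)\<^sup>2 * c x y) = 2 * (\<Sum>x\<in>UNIV. \<psi> $ x * (\<Sum>y\<in>UNIV. (\<psi> $ x - \<psi> $ y) * c x y))"
    proof -
      have "(\<Sum>y\<in>UNIV. ((\<psi> $ y - \<psi> $ x) - (\<psi> $ x - \<psi> $ y)) * c x y)
          = - 2 * (\<Sum>y\<in>UNIV. (\<psi> $ x - \<psi> $ y) * c x y)" for x
        unfolding sum_distrib_left by (intro sum.cong refl) (simp add: algebra_simps)
      then have "- (\<Sum>x\<in>UNIV. \<psi> $ x * (\<Sum>y\<in>UNIV. ((\<psi> $ y - \<psi> $ x) - (\<psi> $ x - \<psi> $ y)) * c x y))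
          = - (\<Sum>x\<in>UNIV. \<psi> $ x * (- 2 * (\<Sum>y\<in>UNIV. (\<psi> $ x - \<psi> $ y) * c x y)))"
        by (simp only:)
      also have "\<dots> = (\<Sum>x\<in>UNIV. 2 * (\<psi> $ x * (\<Sum>y\<in>UNIV. (\<psi> $ x - \<psi> $ y) * c x y)))"
        unfolding sum_negf[symmetric] by (intro sum.cong refl) simp
      finally show ?thesis
        unfolding sum_by_parts[OF c(1), of "\<lambda>x. \<psi> $ x" "\<lambda>x y. \<psi> $ y - \<psi> $ x", symmetric]
        by (simp only: power2_eq_square sum_distrib_left)
    qed
    also have "(\<Sum>x\<in>UNIV. \<psi> $ x * (\<Sum>y\<in>UNIV. (\<psi> $ x - \<psi> $ y) * c x y)) = (\<Sum>x\<in>UNIV. \<psi> $ x * - ?S)"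
      by (intro sum.cong refl arg_cong2[where f = times]) (use eq in \<open>simp add: eq_neg_iff_add_eq_0\<close>)
    also have "\<dots> = - ?S\<^sup>2" by (simp add: power2_eq_square sum_distrib_right sum_negf)
    finally have sum0: "(\<Sum>x\<in>UNIV. \<Sum>y\<in>UNIV. (\<psi> $ y - \<psi> $ x)\<^sup>2 * c x y) = - 2 * ?S\<^sup>2" by simp
    have nn: "0 \<le> (\<psi> $ y - \<psi> $ x)\<^sup>2 * c x y" for x y using c(2) by simp
    have D0: "(\<Sum>x\<in>UNIV. \<Sum>y\<in>UNIV. (\<psi> $ y - \<psi> $ x)\<^sup>2 * c x y) = 0" and S0: "?S = 0"
    proof -
      have "0 \<le> (\<Sum>x\<in>UNIV. \<Sum>y\<in>UNIV. (\<psi> $ y - \<psi> $ x)\<^sup>2 * c x y)" by (intro sum_nonneg nn)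
      with sum0 have "?S\<^sup>2 \<le> 0" by linarith
      then show "?S = 0" by simp
      with sum0 show "(\<Sum>x\<in>UNIV. \<Sum>y\<in>UNIV. (\<psi> $ y - \<psi> $ x)\<^sup>2 * c x y) = 0" by simp
    qed
    have "(\<psi> $ y - \<psi> $ x)\<^sup>2 * c x y = 0" for x y
      using D0 by (simp add: sum_nonneg_eq_0_iff nn sum_nonneg)
    then have same: "\<psi> $ y = \<psi> $ x" if "0 < K x y" for x y
      using c(3)[OF that] by (metis eq_iff_diff_eq_0 less_irrefl mult_eq_0_iff power2_eq_square)
    have const: "\<psi> $ y = \<psi> $ x" for x y
      by (rule irreducible_kernel_propagates[OF K, where P = "\<lambda>z. \<psi> $ z = \<psi> $ x" and x = x]) (auto dest: same)
    have "\<psi> $ x = 0" for x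
    proof -
      have "?S = (\<Sum>y\<in>(UNIV::'a set). \<psi> $ x)" by (intro sum.cong refl const)
      then show ?thesis using S0 by simp
    qed
    then show ?thesis by (simp add: vec_eq_iff)
  qed
  then show ?thesis
    unfolding invertible_det_nz[symmetric] invertible_left_inverse matrix_left_invertible_ker by blast
qed

text \<open>
  Summing the shifted system over all points shows that its solution has zero sum if the right-hand side has. For such
  vectors the shift disappears and the Poisson equation itself is solved.
\<close>

lemma poisson_solution:
  assumes K: "markov_kernel K" "irreducible_kernel K"
    and c: "\<And>x y. c x y = c y x" "\<And>x y. 0 \<le> c x y" "\<And>x y. 0 < K x y \<Longrightarrow> 0 < c x y"
    and f: "(\<Sum>x\<in>UNIV. f x) = 0"
  shows "(\<Sum>y\<in>UNIV. (poisson_solution c f x - poisson_solution c f y) * c x y) = f x"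
proof -
  define \<psi> where "\<psi> = (\<chi> x. poisson_solution c f x)"
  have "shifted_laplacian c *v \<psi> = (\<chi> x. f x)"
    using cramer[of "shifted_laplacian c" \<psi> "\<chi> x. f x"] det_shifted_laplacian[OF K c]
    by (simp add: \<psi>_def poisson_solution_def cong: if_cong)
  then have eq: "(\<Sum>y\<in>UNIV. (\<psi> $ x - \<psi> $ y) * c x y) + (\<Sum>y\<in>UNIV. \<psi> $ y) = f x" for x
    unfolding shifted_laplacian_mult[symmetric] by simp
  have "(\<Sum>x\<in>UNIV. \<Sum>y\<in>UNIV. (\<psi> $ x - \<psi> $ y) * c x y) = 0"
  proof -
    have "(\<Sum>x\<in>UNIV. \<Sum>y\<in>UNIV. \<psi> $ x * c x y) = (\<Sum>x\<in>UNIV. \<Sum>y\<in>UNIV. \<psi> $ y * c x y)"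
      by (subst sum.swap) (simp add: c(1)[symmetric])
    then show ?thesis by (simp add: left_diff_distrib sum_subtractf)
  qed
  moreover have "(\<Sum>x\<in>UNIV. (\<Sum>y\<in>UNIV. (\<psi> $ x - \<psi> $ y) * c x y) + (\<Sum>y\<in>UNIV. \<psi> $ y)) = 0"
    using f eq by simp
  ultimately have "(\<Sum>y\<in>UNIV. \<psi> $ y) = 0" by (simp add: sum.distrib)
  then show ?thesis using eq[of x] by (simp add: \<psi>_def)
qed

lemma measurable_poisson_solution:
  assumes c: "\<And>x y. (\<lambda>t. c t x y) \<in> borel_measurable M" and f: "\<And>x. (\<lambda>t. f t x) \<in> borel_measurable M"
  shows "(\<lambda>t. poisson_solution (c t) (f t) z) \<in> borel_measurable M"
proof -
  have M: "(\<lambda>t. shifted_laplacian (c t) $ x $ y) \<in> borel_measurable M" for x y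
    unfolding shifted_laplacian_def using c
    by (cases "x = y") (auto intro!: borel_measurable_add borel_measurable_diff borel_measurable_sum)
  have N: "(\<lambda>t. if y = z then f t x else shifted_laplacian (c t) $ x $ y) \<in> borel_measurable M" for x y
    using M f by (cases "y = z") auto
  show ?thesis unfolding poisson_solution_def det_def
    by (intro borel_measurable_divide borel_measurable_sum borel_measurable_times borel_measurable_prod
        borel_measurable_const) (simp_all add: M N)
qed

text \<open>
  Among all fluxes with a given divergence, \<open>\<theta> \<nabla>\<psi>\<close> has the least action. Summation by parts turns the Dirichlet energy
  of \<open>\<psi>\<close> into the pairing of \<open>\<nabla>\<psi>\<close> with any such flux, and Young's inequality bounds the pairing
  by half of each of the two actions.
\<close>

lemma gradient_flux_minimises:
  fixes q \<theta> V :: "'a::finite \<Rightarrow> 'a \<Rightarrow> real"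
  assumes q: "\<And>x y. q x y = q y x" "\<And>x y. 0 \<le> q x y"
    and \<theta>: "\<And>x y. \<theta> x y = \<theta> y x" "\<And>x y. 0 < \<theta> x y"
    and div: "\<And>x. (\<Sum>y\<in>UNIV. (\<psi> y - \<psi> x) * \<theta> x y * q x y) = (\<Sum>y\<in>UNIV. (V x y - V y x) * q x y) / 2"
  shows "(\<Sum>x\<in>UNIV. \<Sum>y\<in>UNIV. (\<psi> y - \<psi> x)\<^sup>2 * \<theta> x y * q x y) \<le> (\<Sum>x\<in>UNIV. \<Sum>y\<in>UNIV. (V x y)\<^sup>2 / \<theta> x y * q x y)"
    (is "?D \<le> ?A")
proof -
  have "?D = (\<Sum>x\<in>UNIV. \<Sum>y\<in>UNIV. (\<psi> y - \<psi> x) * ((\<psi> y - \<psi> x) * \<theta> x y) * q x y)"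
    by (simp add: power2_eq_square mult.assoc)
  also have "\<dots> = - (\<Sum>x\<in>UNIV. \<psi> x * (\<Sum>y\<in>UNIV. ((\<psi> y - \<psi> x) * \<theta> x y - (\<psi> x - \<psi> y) * \<theta> y x) * q x y))"
    by (rule sum_by_parts[OF q(1)])
  also have "\<dots> = - (\<Sum>x\<in>UNIV. \<psi> x * (2 * (\<Sum>y\<in>UNIV. (\<psi> y - \<psi> x) * \<theta> x y * q x y)))"
  proof -
    have "(\<Sum>y\<in>UNIV. ((\<psi> y - \<psi> x) * \<theta> x y - (\<psi> x - \<psi> y) * \<theta> y x) * q x y)
        = 2 * (\<Sum>y\<in>UNIV. (\<psi> y - \<psi> x) * \<theta> x y * q x y)" for x
      unfolding sum_distrib_left by (intro sum.cong refl) (simp add: \<theta>(1)[of _ x] algebra_simps)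
    then show ?thesis by simp
  qed
  also have "\<dots> = - (\<Sum>x\<in>UNIV. \<psi> x * (\<Sum>y\<in>UNIV. (V x y - V y x) * q x y))"
    by (simp add: div)
  also have "\<dots> = (\<Sum>x\<in>UNIV. \<Sum>y\<in>UNIV. (\<psi> y - \<psi> x) * V x y * q x y)"
    by (rule sum_by_parts[OF q(1), symmetric])
  also have "\<dots> \<le> (\<Sum>x\<in>UNIV. \<Sum>y\<in>UNIV. ((\<psi> y - \<psi> x)\<^sup>2 * \<theta> x y / 2 + (V x y)\<^sup>2 / \<theta> x y / 2) * q x y)"
  proof (intro sum_mono mult_right_mono q)
    fix x y
    have "0 \<le> ((\<psi> y - \<psi> x) * \<theta> x y - V x y)\<^sup>2 / (2 * \<theta> x y)" using \<theta>(2)[of x y] by simp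
    also have "\<dots> = ((\<psi> y - \<psi> x)\<^sup>2 * \<theta> x y / 2 + (V x y)\<^sup>2 / \<theta> x y / 2) - (\<psi> y - \<psi> x) * V x y"
      using \<theta>(2)[of x y] by (simp add: power2_eq_square field_simps)
    finally show "(\<psi> y - \<psi> x) * V x y \<le> (\<psi> y - \<psi> x)\<^sup>2 * \<theta> x y / 2 + (V x y)\<^sup>2 / \<theta> x y / 2" by simp
  qed
  also have "\<dots> = (?D + ?A) / 2"
    by (simp add: sum.distrib distrib_right sum_divide_distrib add_divide_distrib)
  finally show ?thesis by simp
qed

section \<open>The action of a flux\<close>

lemma discrete_div_scale: "discrete_div K (\<lambda>x y. r * V x y) x = r * discrete_div K V x"
  unfolding discrete_div_def times_divide_eq_right sum_distrib_left
  by (intro arg_cong2[where f = divide] sum.cong refl) (simp add: algebra_simps)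

lemma action_density_scale_flux: "action_density (r * v) s t = ennreal (r\<^sup>2) * action_density v s t"
proof (cases "log_mean s t = 0")
  case True
  then show ?thesis
    by (cases "r = 0") (auto simp: action_density_def ennreal_mult_eq_top_iff)
next
  case False
  then show ?thesis
    by (simp add: action_density_def power_mult_distrib ennreal_mult'[symmetric])
qed

text \<open>
  Larger densities make transport cheaper. This monotonicity is the source of the gain in all later variations.
\<close>

lemma action_density_antimono:
  assumes "0 \<le> s" "0 \<le> t" "s \<le> s'" "t \<le> t'"
  shows "action_density v s' t' \<le> action_density v s t"
proof (cases "log_mean s t = 0")
  case True
  then show ?thesis by (simp add: action_density_def)
next
  case False
  then have "0 < log_mean s t" using log_mean_zero_or_pos assms by blast
  moreover have "log_mean s t \<le> log_mean s' t'" using assms by (rule log_mean_mono)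
  ultimately show ?thesis
    by (auto simp: action_density_def intro!: ennreal_leI divide_left_mono)
qed

lemma action_density_scale_density:
  assumes "0 < c" "0 \<le> s" "0 \<le> t"
  shows "action_density v (c * s) (c * t) = ennreal (1 / c) * action_density v s t"
  using assms by (auto simp: action_density_def log_mean_scale ennreal_mult'[symmetric] ennreal_mult_eq_top_iff)

lemma action_density_eq_0:
  assumes "0 \<le> s" "0 \<le> t" "action_density v s t = 0"
  shows "v = 0"
proof (cases "log_mean s t = 0")
  case True
  then show ?thesis using assms by (simp add: action_density_def split: if_splits)
next
  case False
  then have "0 < log_mean s t" using log_mean_zero_or_pos assms by blast
  moreover from this False assms(3) have "v\<^sup>2 / log_mean s t \<le> 0"
    by (simp add: action_density_def ennreal_eq_0_iff)
  ultimately have "v\<^sup>2 \<le> 0" by (simp add: divide_le_0_iff)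
  then show ?thesis by simp
qed

lemma flux_action_scale_flux: "flux_action K w \<mu> (\<lambda>x y. r * V x y) = ennreal (r\<^sup>2) * flux_action K w \<mu> V"
  by (simp add: flux_action_def action_density_scale_flux sum_distrib_left ennreal_times_divide mult.assoc)

lemma flux_action_scale_density:
  assumes "0 < c" "\<And>x. 0 \<le> \<mu> x"
  shows "flux_action K w (\<lambda>x. c * \<mu> x) V = ennreal (1 / c) * flux_action K w \<mu> V"
  by (simp add: flux_action_def action_density_scale_density assms sum_distrib_left ennreal_times_divide mult.assoc)

lemma flux_action_antimono:
  assumes "\<And>x. 0 \<le> \<mu> x" "\<And>x. \<mu> x \<le> \<nu> x"
  shows "flux_action K w \<nu> V \<le> flux_action K w \<mu> V"
  unfolding flux_action_def
  by (intro divide_right_mono_ennreal sum_mono mult_right_mono action_density_antimono assms) auto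

lemma flux_action_positive:
  assumes "\<And>x. 0 < \<mu> x" "\<And>x y. 0 \<le> K x y" "\<And>x. 0 \<le> w x"
  shows "flux_action K w \<mu> V = ennreal ((\<Sum>x\<in>UNIV. \<Sum>y\<in>UNIV. (V x y)\<^sup>2 / log_mean (\<mu> x) (\<mu> y) * K x y * w x) / 2)"
proof -
  have pos: "0 < log_mean (\<mu> x) (\<mu> y)" for x y using assms(1) by (simp add: log_mean_pos)
  have "action_density (V x y) (\<mu> x) (\<mu> y) * ennreal (K x y) * ennreal (w x)
      = ennreal ((V x y)\<^sup>2 / log_mean (\<mu> x) (\<mu> y) * K x y * w x)" for x y
    unfolding ennreal_mult''[OF assms(3)] ennreal_mult''[OF assms(2)]
    using pos[of x y] by (simp add: action_density_def)
  then have "(\<Sum>x\<in>UNIV. \<Sum>y\<in>UNIV. action_density (V x y) (\<mu> x) (\<mu> y) * ennreal (K x y) * ennreal (w x))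
      = ennreal (\<Sum>x\<in>UNIV. \<Sum>y\<in>UNIV. (V x y)\<^sup>2 / log_mean (\<mu> x) (\<mu> y) * K x y * w x)"
    using pos assms(2,3) by (simp add: sum_ennreal sum_nonneg less_imp_le)
  moreover have "ennreal r / 2 = ennreal (r / 2)" if "0 \<le> r" for r
    using divide_ennreal[of r 2] that by simp
  ultimately show ?thesis
    unfolding flux_action_def using pos assms(2,3) by (simp add: sum_nonneg less_imp_le)
qed

lemma flux_action_term_le:
  "action_density (V x y) (\<mu> x) (\<mu> y) * ennreal (K x y) * ennreal (w x) \<le> 2 * flux_action K w \<mu> V"
proof -
  have "action_density (V x y) (\<mu> x) (\<mu> y) * ennreal (K x y) * ennreal (w x)
      \<le> (\<Sum>y\<in>UNIV. action_density (V x y) (\<mu> x) (\<mu> y) * ennreal (K x y) * ennreal (w x))"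
    by (rule member_le_sum) auto
  also have "\<dots> \<le> (\<Sum>x\<in>UNIV. \<Sum>y\<in>UNIV. action_density (V x y) (\<mu> x) (\<mu> y) * ennreal (K x y) * ennreal (w x))"
    by (rule member_le_sum[of x UNIV "\<lambda>x. \<Sum>y\<in>UNIV. action_density (V x y) (\<mu> x) (\<mu> y) * ennreal (K x y) * ennreal (w x)"]) auto
  also have "\<dots> = 2 * flux_action K w \<mu> V"
    unfolding flux_action_def ennreal_times_divide mult.commute[of 2] by (rule mult_divide_eq_ennreal[symmetric]) auto
  finally show ?thesis .
qed

text \<open>
  An edge with a vacant endpoint carries no flux if the action is finite, because the action density is infinite there
  for every nonzero flux.
\<close>

lemma finite_flux_action_degenerate_edge:
  assumes "flux_action K w \<mu> V \<noteq> \<infinity>" "0 < K x y" "0 < w x" "log_mean (\<mu> x) (\<mu> y) = 0"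
  shows "V x y = 0"
proof (rule ccontr)
  assume "V x y \<noteq> 0"
  then have "action_density (V x y) (\<mu> x) (\<mu> y) * ennreal (K x y) * ennreal (w x) = \<infinity>"
    using assms by (simp add: action_density_def ennreal_mult_eq_top_iff)
  then have "2 * flux_action K w \<mu> V = \<infinity>"
    using flux_action_term_le[of V x y \<mu> K w] by (simp add: top_unique)
  then show False using assms(1) by (simp add: ennreal_mult_eq_top_iff)
qed

lemma flux_action_eq_0:
  assumes "flux_action K w \<mu> V = 0" "0 < K x y" "0 < w x" "\<And>x. 0 \<le> \<mu> x"
  shows "V x y = 0"
proof -
  have "action_density (V x y) (\<mu> x) (\<mu> y) * ennreal (K x y) * ennreal (w x) = 0"
    using flux_action_term_le[of V x y \<mu> K w] assms by simp
  then have "action_density (V x y) (\<mu> x) (\<mu> y) = 0"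
    using assms by (auto simp: ennreal_eq_0_iff)
  then show ?thesis using action_density_eq_0 assms(4) by blast
qed

lemma measurable_flux_action:
  assumes \<mu>: "\<And>x. (\<lambda>t. \<mu> t x) \<in> borel_measurable M" "\<And>t x. t \<in> space M \<Longrightarrow> 0 \<le> \<mu> t x"
    and V: "\<And>x y. (\<lambda>t. V t x y) \<in> borel_measurable M"
  shows "(\<lambda>t. flux_action K w (\<mu> t) (V t)) \<in> borel_measurable M"
proof -
  have [measurable]: "(\<lambda>t. log_mean (\<mu> t x) (\<mu> t y)) \<in> borel_measurable M" for x y
    using \<mu> by (intro measurable_log_mean) auto
  note V[measurable]
  have [measurable]: "(\<lambda>t. action_density (V t x y) (\<mu> t x) (\<mu> t y)) \<in> borel_measurable M" for x y
    unfolding action_density_def by measurable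
  show ?thesis unfolding flux_action_def
    by (intro borel_measurable_divide_ennreal borel_measurable_sum borel_measurable_times_ennreal) auto
qed

section \<open>Solutions of the continuity equation\<close>

lemma CE_D:
  assumes "(\<mu>, V, h) \<in> CE K p \<mu>0 \<mu>1"
  shows "\<And>t x. t \<in> {0..1} \<Longrightarrow> 0 \<le> \<mu> t x"
    and "\<And>x. abs_continuous_on_interval 0 1 (\<lambda>t. \<mu> t x)"
    and "\<mu> 0 = \<mu>0" "\<mu> 1 = \<mu>1"
    and "\<And>x y. (\<lambda>t. V t x y) \<in> borel_measurable (lebesgue_on {0..1})"
    and "h \<in> borel_measurable (lebesgue_on {0..1})"
    and "AE t in lebesgue_on {0..1}. \<forall>x.
        ((\<lambda>s. \<mu> s x) has_real_derivative h t * p x - discrete_div K (V t) x) (at t within {0..1})"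
  using assms by (auto simp: CE_def ac_curve_between_def densities_def)

lemma measurable_CE_flux_action:
  assumes "(\<mu>, V, h) \<in> CE K p \<mu>0 \<mu>1"
  shows "(\<lambda>t. flux_action K w (\<mu> t) (V t)) \<in> borel_measurable (lebesgue_on {0..1})"
  by (intro measurable_flux_action abs_continuous_measurable CE_D(2)[OF assms] CE_D(5)[OF assms])
    (auto intro: CE_D(1)[OF assms])

text \<open>
  The one-parameter variation of the whole proof: extra mass \<open>\<epsilon> G p\<close> is created and removed by the source alone, so that the
  flux and the endpoints do not change.
\<close>

lemma CE_perturb:
  assumes CE: "(\<mu>, V, h) \<in> CE K p \<mu>0 \<mu>1" and p: "\<And>x. 0 \<le> p x"
    and G: "abs_continuous_on_interval 0 1 G" "\<And>t. t \<in> {0..1} \<Longrightarrow> 0 \<le> G t" "G 0 = 0" "G 1 = 0"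
    and g: "g \<in> borel_measurable (lebesgue_on {0..1})"
      "AE t in lebesgue_on {0..1}. (G has_real_derivative g t) (at t within {0..1})"
    and \<epsilon>: "0 \<le> \<epsilon>"
  shows "(\<lambda>t x. \<mu> t x + \<epsilon> * G t * p x, V, \<lambda>t. h t + \<epsilon> * g t) \<in> CE K p \<mu>0 \<mu>1"
proof -
  note D = CE_D[OF CE]
  have "abs_continuous_on_interval 0 1 (\<lambda>t. \<mu> t x + \<epsilon> * G t * p x)" for x
  proof (rule abs_continuous_add[OF D(2)])
    show "abs_continuous_on_interval 0 1 (\<lambda>t. \<epsilon> * G t * p x)"
      using abs_continuous_cmult[OF G(1), of "\<epsilon> * p x"] by (simp add: mult_ac)
  qed
  moreover have "AE t in lebesgue_on {0..1}. \<forall>x. ((\<lambda>t. \<mu> t x + \<epsilon> * G t * p x) has_real_derivative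
      (h t + \<epsilon> * g t) * p x - discrete_div K (V t) x) (at t within {0..1})"
    using D(7) g(2)
  proof eventually_elim
    case (elim t)
    show ?case
    proof
      fix x
      show "((\<lambda>t. \<mu> t x + \<epsilon> * G t * p x) has_real_derivative
        (h t + \<epsilon> * g t) * p x - discrete_div K (V t) x) (at t within {0..1})"
        using elim by (auto intro!: derivative_eq_intros elim(2) simp: algebra_simps)
    qed
  qed
  ultimately show ?thesis
    using D G p \<epsilon> g(1) by (auto simp: CE_def ac_curve_between_def densities_def)
qed

section \<open>Reversible chains with a source\<close>

locale transport_setting =
  fixes K :: "'a::finite \<Rightarrow> 'a \<Rightarrow> real" and w p :: "'a \<Rightarrow> real" and a b :: real
  assumes markov: "markov_kernel K" and irreducible: "irreducible_kernel K"
    and invariant: "invariant_probability K w" and reversible: "reversible_kernel K w"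
    and a_pos: "0 < a" and b_pos: "0 < b"
    and p_pos_densities: "p \<in> pos_densities" and p_mass: "(\<Sum>x\<in>UNIV. p x * w x) = 1"
begin

lemma w_pos: "0 < w x"
  using invariant_probability_pos[OF markov irreducible invariant reversible] .

lemma p_pos: "0 < p x"
  using p_pos_densities by (simp add: pos_densities_def)

lemma K_nonneg: "0 \<le> K x y"
  using markov by (simp add: markov_kernel_def)

lemma detailed_balance: "K x y * w x = K y x * w y"
  using reversible unfolding reversible_kernel_def by blast

lemma K_pos_commute: "0 < K x y \<longleftrightarrow> 0 < K y x"
  using detailed_balance[of x y] w_pos[of x] w_pos[of y]
  by (metis mult_pos_pos zero_less_mult_pos2)

text \<open>
  Transport conserves mass, by reversibility.
\<close>

lemma sum_discrete_div: "(\<Sum>x\<in>UNIV. discrete_div K U x * w x) = 0"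
proof -
  have "(\<Sum>x\<in>UNIV. \<Sum>y\<in>UNIV. (U x y - U y x) * (K x y * w x)) = 0"
    using sum_by_parts[of "\<lambda>x y. K x y * w x" "\<lambda>_. 1" U] detailed_balance by simp
  then show ?thesis
    by (simp add: discrete_div_def sum_distrib_right mult.assoc flip: sum_divide_distrib)
qed

lemma discrete_div_eq_0:
  assumes "\<And>y. 0 < K x y \<Longrightarrow> U x y = 0 \<and> U y x = 0"
  shows "discrete_div K U x = 0"
proof -
  have "(U x y - U y x) * K x y = 0" for y
    using assms[of y] K_nonneg[of x y] by (cases "0 < K x y") auto
  then have "(\<Sum>y\<in>UNIV. (U x y - U y x) * K x y) = 0" by (intro sum.neutral ballI)
  then show ?thesis by (simp add: discrete_div_def)
qed

section \<open>Fluxes cannot beat potentials\<close>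

text \<open>
  If the densities are positive in the open time interval, then all weights \<open>\<theta>(\<mu>\<^sub>t(x), \<mu>\<^sub>t(y)) K(x,y) \<varpi>(x)\<close> on edges are positive
  and the Poisson equation with right-hand side the divergence of the flux is solvable at almost every time. Its solution is
  an admissible potential, whose energy does not exceed that of the flux.
\<close>

lemma W_squared_le_E_Quad_of_positive:
  assumes CE: "(\<mu>, V, h) \<in> CE K p \<mu>0 \<mu>1" and pos: "\<And>t x. 0 < t \<Longrightarrow> t < 1 \<Longrightarrow> 0 < \<mu> t x"
  shows "W_squared K w p a b \<mu>0 \<mu>1 \<le> E_Quad K w a b \<mu> V h"
proof -
  note D = CE_D[OF CE]
  define q where "q = (\<lambda>x y. K x y * w x)"
  define \<theta> where "\<theta> = (\<lambda>t x y. log_mean (\<mu> t x) (\<mu> t y))"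
  define \<psi> where "\<psi> = (\<lambda>t. poisson_solution (\<lambda>x y. \<theta> t x y * q x y) (\<lambda>x. - discrete_div K (V t) x * w x))"
  have q: "q x y = q y x" "0 \<le> q x y" "0 < K x y \<Longrightarrow> 0 < q x y" for x y
    unfolding q_def
    by (rule detailed_balance) (simp_all add: K_nonneg w_pos less_imp_le)
  have \<theta>: "\<theta> t x y = \<theta> t y x" "0 < \<theta> t x y" if "0 < t" "t < 1" for t x y
    using pos[OF that] by (auto simp: \<theta>_def log_mean_pos less_imp_le intro: log_mean_commute)
  have weighted: "(\<Sum>y\<in>UNIV. (\<psi> t y - \<psi> t x) * \<theta> t x y * q x y) = discrete_div K (V t) x * w x"
    if "0 < t" "t < 1" for t x
  proof -
    have "(\<Sum>y\<in>UNIV. (\<psi> t x - \<psi> t y) * (\<theta> t x y * q x y)) = - discrete_div K (V t) x * w x"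
      unfolding \<psi>_def
    proof (rule poisson_solution[OF markov irreducible])
      show "\<theta> t x y * q x y = \<theta> t y x * q y x" "0 \<le> \<theta> t x y * q x y" "0 < K x y \<Longrightarrow> 0 < \<theta> t x y * q x y" for x y
        using q[of x y] \<theta>[OF that, of x y] by auto
      show "(\<Sum>x\<in>UNIV. - discrete_div K (V t) x * w x) = 0"
        using sum_discrete_div[of "V t"] by (simp add: sum_negf)
    qed
    moreover have "(\<Sum>y\<in>UNIV. (\<psi> t y - \<psi> t x) * \<theta> t x y * q x y) = - (\<Sum>y\<in>UNIV. (\<psi> t x - \<psi> t y) * (\<theta> t x y * q x y))"
      unfolding sum_negf[symmetric] by (intro sum.cong refl) (simp add: algebra_simps)
    ultimately show ?thesis by simp
  qed
  have key: "(\<Sum>y\<in>UNIV. (\<psi> t y - \<psi> t x) * \<theta> t x y * K x y) = discrete_div K (V t) x"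
    if "0 < t" "t < 1" for t x
  proof -
    have "(\<Sum>y\<in>UNIV. (\<psi> t y - \<psi> t x) * \<theta> t x y * K x y) * w x = discrete_div K (V t) x * w x"
      unfolding weighted[OF that, symmetric] by (simp add: sum_distrib_right q_def mult.assoc)
    then show ?thesis using w_pos[of x] by simp
  qed
  have interior: "AE t in lebesgue_on {0..1}. t \<notin> {0, 1::real}"
    by (rule AE_lebesgue_on_negligible) auto
  have "(\<mu>, \<psi>, h) \<in> potential_triples K p \<mu>0 \<mu>1"
  proof -
    have "(\<lambda>t. \<theta> t x y) \<in> borel_measurable (lebesgue_on {0..1})" for x y
      unfolding \<theta>_def by (intro measurable_log_mean abs_continuous_measurable D(2)) (auto intro: D(1))
    moreover have "(\<lambda>t. discrete_div K (V t) x) \<in> borel_measurable (lebesgue_on {0..1})" for x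
      unfolding discrete_div_def
      by (intro borel_measurable_divide borel_measurable_sum borel_measurable_times borel_measurable_diff D(5) borel_measurable_const)
    ultimately have "(\<lambda>t. \<psi> t x) \<in> borel_measurable (lebesgue_on {0..1})" for x
      unfolding \<psi>_def
      by (intro measurable_poisson_solution borel_measurable_times borel_measurable_const borel_measurable_uminus)
    moreover have "AE t in lebesgue_on {0..1}. \<forall>x.
        ((\<lambda>s. \<mu> s x) has_real_derivative
           h t * p x - (\<Sum>y\<in>UNIV. (\<psi> t y - \<psi> t x) * log_mean (\<mu> t x) (\<mu> t y) * K x y))
        (at t within {0..1})"
      using D(7) interior AE_space
    proof eventually_elim
      case (elim t)
      then have "0 < t" "t < 1" by auto
      then show ?case using elim(1) key[unfolded \<theta>_def] by simp
    qed
    ultimately show ?thesis using CE by (auto simp: potential_triples_def CE_def)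
  qed
  then have "W_squared K w p a b \<mu>0 \<mu>1 \<le> potential_energy K w a b \<mu> \<psi> h"
    unfolding W_squared_def by (rule INF_lower2) simp
  also have "\<dots> \<le> E_Quad K w a b \<mu> V h"
    unfolding potential_energy_def E_Quad_def
  proof (intro add_mono mult_left_mono nn_integral_mono_AE)
    show "AE t in lebesgue_on {0..1}. ennreal ((\<Sum>x\<in>UNIV. \<Sum>y\<in>UNIV.
        (\<psi> t y - \<psi> t x)\<^sup>2 * log_mean (\<mu> t x) (\<mu> t y) * K x y * w x) / 2) \<le> flux_action K w (\<mu> t) (V t)"
      using interior AE_space
    proof eventually_elim
      case (elim t)
      then have t: "0 < t" "t < 1" by auto
      have "(\<Sum>x\<in>UNIV. \<Sum>y\<in>UNIV. (\<psi> t y - \<psi> t x)\<^sup>2 * \<theta> t x y * q x y) \<le> (\<Sum>x\<in>UNIV. \<Sum>y\<in>UNIV. (V t x y)\<^sup>2 / \<theta> t x y * q x y)"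
      proof (rule gradient_flux_minimises)
        show "(\<Sum>y\<in>UNIV. (\<psi> t y - \<psi> t x) * \<theta> t x y * q x y) = (\<Sum>y\<in>UNIV. (V t x y - V t y x) * q x y) / 2" for x
          unfolding weighted[OF t] by (simp add: discrete_div_def q_def sum_distrib_right mult.assoc)
      qed (use q \<theta>[OF t] in auto)
      then show ?case
        by (subst flux_action_positive) (auto intro!: ennreal_leI simp: pos[OF t] K_nonneg w_pos less_imp_le \<theta>_def q_def mult.assoc)
    qed
  qed auto
  finally show ?thesis .
qed

text \<open>
  The curve \<open>\<mu>\<^sub>t + \<kappa> t (1 - t) p\<close> is positive in the open interval, its action is not larger, and its source differs from \<open>h\<close> by
  \<open>\<kappa> (1 - 2 t)\<close>. The cost of the source is controlled by \<open>2 h g \<le> h\<^sup>2 + g\<^sup>2\<close> and tends to the original one as \<open>\<kappa> \<rightarrow> 0\<close>.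
\<close>

lemma W_squared_le_E_Quad:
  assumes CE: "(\<mu>, V, h) \<in> CE K p \<mu>0 \<mu>1"
  shows "W_squared K w p a b \<mu>0 \<mu>1 \<le> E_Quad K w a b \<mu> V h"
proof (cases "E_Quad K w a b \<mu> V h = \<infinity>")
  case False
  note D = CE_D[OF CE]
  define E where "E = E_Quad K w a b \<mu> V h"
  let ?H = "\<integral>\<^sup>+ t. ennreal (\<bar>h t\<bar>\<^sup>2) \<partial>lebesgue_on {0..1}"
  let ?A = "\<integral>\<^sup>+ t. flux_action K w (\<mu> t) (V t) \<partial>lebesgue_on {0..1}"
  define G where "G = (\<lambda>t::real. t * (1 - t))"
  define g where "g = (\<lambda>t::real. 1 - 2 * t)"
  have dG: "(G has_real_derivative g t) (at t within {0..1})" for t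
    unfolding G_def g_def by (auto intro!: derivative_eq_intros)
  have G: "abs_continuous_on_interval 0 1 G"
    by (rule abs_continuous_bounded_derivative[where f' = g and L = 1], rule dG) (auto simp: g_def)
  have bound: "W_squared K w p a b \<mu>0 \<mu>1 \<le> ennreal (1 + \<kappa>) * E + ennreal ((\<kappa> + \<kappa>\<^sup>2) * a\<^sup>2)" if \<kappa>: "0 < \<kappa>" for \<kappa>
  proof -
    let ?\<mu> = "\<lambda>t x. \<mu> t x + \<kappa> * G t * p x" and ?h = "\<lambda>t. h t + \<kappa> * g t"
    have "(?\<mu>, V, ?h) \<in> CE K p \<mu>0 \<mu>1"
    proof (rule CE_perturb[OF CE _ G])
      show "g \<in> borel_measurable (lebesgue_on {0..1})"
        unfolding g_def by (intro continuous_imp_measurable_on_sets_lebesgue continuous_intros) auto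
      show "AE t in lebesgue_on {0..1}. (G has_real_derivative g t) (at t within {0..1})"
        using dG by simp
    qed (use \<kappa> p_pos in \<open>auto simp: G_def less_imp_le\<close>)
    then have "W_squared K w p a b \<mu>0 \<mu>1 \<le> E_Quad K w a b ?\<mu> V ?h"
    proof (rule W_squared_le_E_Quad_of_positive)
      fix t x assume t: "0 < t" "t < (1::real)"
      have "0 < \<kappa> * G t * p x" using t \<kappa> p_pos by (simp add: G_def)
      then show "0 < \<mu> t x + \<kappa> * G t * p x" using D(1)[of t x] t by auto
    qed
    also have "\<dots> \<le> ennreal (a\<^sup>2) * (ennreal (1 + \<kappa>) * ?H + ennreal (\<kappa> + \<kappa>\<^sup>2)) + ennreal (b\<^sup>2) * ?A"
      unfolding E_Quad_def
    proof (intro add_mono mult_left_mono)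
      have "(\<integral>\<^sup>+ t. ennreal (\<bar>h t + \<kappa> * g t\<bar>\<^sup>2) \<partial>lebesgue_on {0..1})
          \<le> (\<integral>\<^sup>+ t. ennreal (1 + \<kappa>) * ennreal (\<bar>h t\<bar>\<^sup>2) + ennreal (\<kappa> + \<kappa>\<^sup>2) \<partial>lebesgue_on {0..1})"
      proof (rule nn_integral_mono)
        fix t :: real assume "t \<in> space (lebesgue_on {0..1})"
        then have "\<bar>g t\<bar> \<le> 1" by (auto simp: g_def)
        then have g1: "(g t)\<^sup>2 \<le> 1" by (simp add: abs_square_le_1)
        have "0 \<le> \<kappa> * (h t - g t)\<^sup>2" using \<kappa> by simp
        then have "(h t + \<kappa> * g t)\<^sup>2 \<le> (1 + \<kappa>) * (h t)\<^sup>2 + (\<kappa> + \<kappa>\<^sup>2) * (g t)\<^sup>2"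
          by (simp add: power2_eq_square algebra_simps)
        also have "\<dots> \<le> (1 + \<kappa>) * (h t)\<^sup>2 + (\<kappa> + \<kappa>\<^sup>2)"
          using mult_left_mono[OF g1, of "\<kappa> + \<kappa>\<^sup>2"] \<kappa> by simp
        finally show "ennreal (\<bar>h t + \<kappa> * g t\<bar>\<^sup>2) \<le> ennreal (1 + \<kappa>) * ennreal (\<bar>h t\<bar>\<^sup>2) + ennreal (\<kappa> + \<kappa>\<^sup>2)"
          using \<kappa> by (simp add: ennreal_mult'[symmetric] ennreal_plus[symmetric] ennreal_leI del: ennreal_plus)
      qed
      also have "\<dots> = ennreal (1 + \<kappa>) * ?H + ennreal (\<kappa> + \<kappa>\<^sup>2)"
        using D(6) by (simp add: nn_integral_add nn_integral_cmult emeasure_restrict_space)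
      finally show "(\<integral>\<^sup>+ t. ennreal (\<bar>h t + \<kappa> * g t\<bar>\<^sup>2) \<partial>lebesgue_on {0..1}) \<le> \<dots>" .
      show "(\<integral>\<^sup>+ t. flux_action K w (?\<mu> t) (V t) \<partial>lebesgue_on {0..1}) \<le> ?A"
        using D(1) \<kappa> p_pos by (intro nn_integral_mono flux_action_antimono) (auto simp: G_def less_imp_le)
    qed auto
    also have "\<dots> \<le> ennreal (1 + \<kappa>) * E + ennreal ((\<kappa> + \<kappa>\<^sup>2) * a\<^sup>2)"
    proof -
      have "ennreal (b\<^sup>2) * ?A \<le> ennreal (1 + \<kappa>) * (ennreal (b\<^sup>2) * ?A)"
        using \<kappa> mult_right_mono[of 1 "ennreal (1 + \<kappa>)" "ennreal (b\<^sup>2) * ?A"] by simp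
      moreover have "ennreal ((\<kappa> + \<kappa>\<^sup>2) * a\<^sup>2) = ennreal (a\<^sup>2) * ennreal (\<kappa> + \<kappa>\<^sup>2)"
        by (simp add: ennreal_mult'[symmetric] mult.commute)
      ultimately show ?thesis
        unfolding E_def E_Quad_def by (simp add: distrib_left mult.left_commute add.commute add.left_commute add_left_mono)
    qed
    finally show ?thesis .
  qed
  obtain r where r: "E = ennreal r" "0 \<le> r" using False by (cases E) (auto simp: E_def)
  have "W_squared K w p a b \<mu>0 \<mu>1 \<le> ennreal r"
  proof (rule tendsto_lowerbound)
    show "((\<lambda>\<kappa>. ennreal ((1 + \<kappa>) * r + (\<kappa> + \<kappa>\<^sup>2) * a\<^sup>2)) \<longlongrightarrow> ennreal r) (at_right 0)"
      by (intro tendsto_ennrealI tendsto_eq_intros) auto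
    show "\<forall>\<^sub>F \<kappa> in at_right 0. W_squared K w p a b \<mu>0 \<mu>1 \<le> ennreal ((1 + \<kappa>) * r + (\<kappa> + \<kappa>\<^sup>2) * a\<^sup>2)"
      using eventually_at_right_less[of 0]
    proof eventually_elim
      case (elim \<kappa>)
      have "ennreal (1 + \<kappa>) * E + ennreal ((\<kappa> + \<kappa>\<^sup>2) * a\<^sup>2) = ennreal ((1 + \<kappa>) * r + (\<kappa> + \<kappa>\<^sup>2) * a\<^sup>2)"
        using elim r by (simp add: ennreal_mult'[symmetric] ennreal_plus[symmetric] del: ennreal_plus)
      then show ?case using bound[OF elim] by simp
    qed
  qed simp
  then show ?thesis using r by (simp add: E_def)
qed simp

text \<open>
  A curve of finite energy is \<open>(1 - s(t)) \<mu>\<^sub>0 + s(t) \<mu>\<^sub>1 + t (1 - t) p\<close> with \<open>s(t) = 3 t\<^sup>2 - 2 t\<^sup>3\<close>. Its flux is \<open>s'(t)\<close> times a fixed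
  gradient, and its density is at least \<open>t (1 - t) p\<close>. The choice of \<open>s\<close> gives \<open>s'(t) = 6 t (1 - t)\<close>, so that
  \<open>s'(t)\<^sup>2 / (t (1 - t))\<close> stays bounded although the endpoints may have zeros.
\<close>

lemma W_squared_finite:
  assumes \<mu>0: "\<mu>0 \<in> densities" and \<mu>1: "\<mu>1 \<in> densities"
  shows "W_squared K w p a b \<mu>0 \<mu>1 < \<infinity>"
proof -
  define d where "d = (\<lambda>x. \<mu>1 x - \<mu>0 x)"
  define m where "m = (\<Sum>x\<in>UNIV. d x * w x)"
  define f where "f = (\<lambda>x. m * p x - d x)"
  define \<phi> where "\<phi> = poisson_solution (\<lambda>x y. K x y * w x) (\<lambda>x. - f x * w x)"
  define V where "V = (\<lambda>x y. \<phi> y - \<phi> x)"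
  define s where "s = (\<lambda>t::real. 3 * t\<^sup>2 - 2 * t ^ 3)"
  define s' where "s' = (\<lambda>t::real. 6 * (t * (1 - t)))"
  define \<mu> where "\<mu> = (\<lambda>t x. \<mu>0 x + s t * d x + t * (1 - t) * p x)"
  define h where "h = (\<lambda>t. s' t * m + (1 - 2 * t))"
  have div: "discrete_div K V x = f x" for x
  proof -
    have "(\<Sum>y\<in>UNIV. (\<phi> x - \<phi> y) * (K x y * w x)) = - f x * w x"
      unfolding \<phi>_def
    proof (rule poisson_solution[OF markov irreducible])
      show "(\<Sum>x\<in>UNIV. - f x * w x) = 0"
        using p_mass by (simp add: f_def m_def left_diff_distrib sum_subtractf mult.assoc flip: sum_distrib_left)
    qed (simp_all add: detailed_balance K_nonneg w_pos less_imp_le)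
    moreover have "(\<Sum>y\<in>UNIV. (\<phi> x - \<phi> y) * (K x y * w x)) = - discrete_div K V x * w x"
      unfolding discrete_div_def V_def sum_divide_distrib sum_negf[symmetric] sum_distrib_right
      by (intro sum.cong refl) (simp add: field_simps)
    ultimately show ?thesis using w_pos[of x] by simp
  qed
  have der: "((\<lambda>t. \<mu> t x) has_real_derivative s' t * d x + (1 - 2 * t) * p x) (at t within {0..1})" for t x
    unfolding \<mu>_def s_def s'_def by (auto intro!: derivative_eq_intros simp: power2_eq_square algebra_simps)
  have s'01: "0 \<le> s' t" "s' t \<le> 6" if "t \<in> {0..1}" for t
  proof -
    show "0 \<le> s' t" using that by (simp add: s'_def)
    have "t * (1 - t) \<le> 1 * 1" using that by (intro mult_mono) auto
    then show "s' t \<le> 6" by (simp add: s'_def)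
  qed
  have s01: "0 \<le> s t" "s t \<le> 1" if "t \<in> {0..1}" for t
  proof -
    have "s t = t\<^sup>2 * (3 - 2 * t)" "1 - s t = (1 - t)\<^sup>2 * (1 + 2 * t)"
      by (simp_all add: s_def power2_eq_square power3_eq_cube algebra_simps)
    then show "0 \<le> s t" "s t \<le> 1" using that
      by (simp, metis atLeastAtMost_iff add_nonneg_nonneg diff_ge_0_iff_ge mult_nonneg_nonneg zero_le_numeral zero_le_one zero_le_power2)
  qed
  have ge: "t * (1 - t) * p x \<le> \<mu> t x" if "t \<in> {0..1}" for t x
  proof -
    have "0 \<le> (1 - s t) * \<mu>0 x + s t * \<mu>1 x"
      using s01[OF that] \<mu>0 \<mu>1 by (simp add: densities_def)
    then show ?thesis by (simp add: \<mu>_def d_def algebra_simps)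
  qed
  have Gp: "0 \<le> t * (1 - t) * p x" if "t \<in> {0..1}" for t x
    using that p_pos[of x] by simp
  have CE: "(\<mu>, \<lambda>t x y. s' t * V x y, h) \<in> CE K p \<mu>0 \<mu>1"
  proof -
    have "abs_continuous_on_interval 0 1 (\<lambda>t. \<mu> t x)" for x
    proof (rule abs_continuous_bounded_derivative)
      show "((\<lambda>t. \<mu> t x) has_real_derivative s' t * d x + (1 - 2 * t) * p x) (at t within {0..1})" for t
        by (rule der)
      fix t :: real assume t: "t \<in> {0..1}"
      have "\<bar>s' t * d x\<bar> \<le> 6 * \<bar>d x\<bar>" "\<bar>(1 - 2 * t) * p x\<bar> \<le> 1 * \<bar>p x\<bar>"
        unfolding abs_mult using s'01[OF t] t by (intro mult_right_mono; simp add: abs_le_iff)+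
      then show "\<bar>s' t * d x + (1 - 2 * t) * p x\<bar> \<le> 6 * \<bar>d x\<bar> + \<bar>p x\<bar>" by linarith
    qed
    moreover have "\<mu> t \<in> densities" if "t \<in> {0..1}" for t
      unfolding densities_def using order_trans[OF Gp[OF that] ge[OF that]] by simp
    moreover have "\<mu> 0 = \<mu>0" "\<mu> 1 = \<mu>1" by (auto simp: \<mu>_def s_def d_def)
    moreover have "(\<lambda>t. s' t * V x y) \<in> borel_measurable (lebesgue_on {0..1})" for x y
      unfolding s'_def by (intro continuous_imp_measurable_on_sets_lebesgue continuous_intros) auto
    moreover have "h \<in> borel_measurable (lebesgue_on {0..1})"
      unfolding h_def s'_def by (intro continuous_imp_measurable_on_sets_lebesgue continuous_intros) auto
    moreover have "((\<lambda>t. \<mu> t x) has_real_derivative h t * p x - discrete_div K (\<lambda>x y. s' t * V x y) x) (at t within {0..1})" for t x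
    proof -
      have eq: "h t * p x - discrete_div K (\<lambda>x y. s' t * V x y) x = s' t * d x + (1 - 2 * t) * p x"
        unfolding discrete_div_scale div h_def f_def by (simp add: algebra_simps)
      show ?thesis unfolding eq by (rule der)
    qed
    ultimately show ?thesis by (auto simp: CE_def ac_curve_between_def)
  qed
  have "W_squared K w p a b \<mu>0 \<mu>1 \<le> E_Quad K w a b \<mu> (\<lambda>t x y. s' t * V x y) h"
    by (rule W_squared_le_E_Quad[OF CE])
  also have "\<dots> \<le> ennreal (a\<^sup>2) * (\<integral>\<^sup>+ t. ennreal ((6 * \<bar>m\<bar> + 1)\<^sup>2) \<partial>lebesgue_on {0..1::real}) +
      ennreal (b\<^sup>2) * (\<integral>\<^sup>+ t. ennreal 36 * flux_action K w p V \<partial>lebesgue_on {0..1::real})"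
    unfolding E_Quad_def
  proof (intro add_mono mult_left_mono)
    show "(\<integral>\<^sup>+ t. ennreal (\<bar>h t\<bar>\<^sup>2) \<partial>lebesgue_on {0..1})
        \<le> (\<integral>\<^sup>+ t. ennreal ((6 * \<bar>m\<bar> + 1)\<^sup>2) \<partial>lebesgue_on {0..1::real})"
    proof (rule nn_integral_mono)
      fix t :: real assume "t \<in> space (lebesgue_on {0..1})"
      then have t: "t \<in> {0..1}" by simp
      have "\<bar>s' t * m\<bar> \<le> 6 * \<bar>m\<bar>" "\<bar>1 - 2 * t\<bar> \<le> 1"
        unfolding abs_mult using s'01[OF t] t by (auto intro!: mult_right_mono)
      then have "\<bar>h t\<bar> \<le> 6 * \<bar>m\<bar> + 1" unfolding h_def by linarith
      then show "ennreal (\<bar>h t\<bar>\<^sup>2) \<le> ennreal ((6 * \<bar>m\<bar> + 1)\<^sup>2)" by (intro ennreal_leI power_mono) auto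
    qed
    have "AE t in lebesgue_on {0..1}. t \<notin> {0, 1::real}"
      by (rule AE_lebesgue_on_negligible) auto
    then have "AE t in lebesgue_on {0..1}. flux_action K w (\<mu> t) (\<lambda>x y. s' t * V x y) \<le> ennreal 36 * flux_action K w p V"
      using AE_space
    proof eventually_elim
      case (elim t)
      then have t: "0 < t" "t < 1" "t \<in> {0..1}" by auto
      have tt: "0 < t * (1 - t)" using t by simp
      have "flux_action K w (\<mu> t) (\<lambda>x y. s' t * V x y) = ennreal ((s' t)\<^sup>2) * flux_action K w (\<mu> t) V"
        by (rule flux_action_scale_flux)
      also have "\<dots> \<le> ennreal ((s' t)\<^sup>2) * flux_action K w (\<lambda>x. (t * (1 - t)) * p x) V"
        using ge[OF t(3)] Gp[OF t(3)] by (intro mult_left_mono flux_action_antimono) auto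
      also have "\<dots> = ennreal ((s' t)\<^sup>2) * (ennreal (1 / (t * (1 - t))) * flux_action K w p V)"
        using tt p_pos by (subst flux_action_scale_density) (auto simp: less_imp_le)
      also have "\<dots> = ennreal ((s' t)\<^sup>2 * (1 / (t * (1 - t)))) * flux_action K w p V"
        by (simp only: ennreal_mult'[OF zero_le_power2] mult.assoc)
      also have "(s' t)\<^sup>2 * (1 / (t * (1 - t))) = 6 * s' t"
        using tt by (simp add: s'_def power2_eq_square)
      also have "ennreal (6 * s' t) * flux_action K w p V \<le> ennreal 36 * flux_action K w p V"
        using s'01[OF t(3)] by (intro mult_right_mono ennreal_leI) auto
      finally show ?case .
    qed
    then show "(\<integral>\<^sup>+ t. flux_action K w (\<mu> t) (\<lambda>x y. s' t * V x y) \<partial>lebesgue_on {0..1})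
        \<le> (\<integral>\<^sup>+ t. ennreal 36 * flux_action K w p V \<partial>lebesgue_on {0..1::real})"
      by (rule nn_integral_mono_AE)
  qed auto
  also have "\<dots> < \<infinity>"
    using p_pos K_nonneg w_pos
    by (simp add: emeasure_restrict_space flux_action_positive less_imp_le ennreal_mult_less_top)
  finally show ?thesis .
qed

section \<open>Energy density and total mass\<close>

definition energy_density :: "(real \<Rightarrow> 'a \<Rightarrow> real) \<Rightarrow> (real \<Rightarrow> 'a \<Rightarrow> 'a \<Rightarrow> real) \<Rightarrow> (real \<Rightarrow> real) \<Rightarrow> real \<Rightarrow> ennreal" where
  "energy_density \<mu> V h t = ennreal (a\<^sup>2) * ennreal (\<bar>h t\<bar>\<^sup>2) + ennreal (b\<^sup>2) * flux_action K w (\<mu> t) (V t)"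

lemma measurable_energy_density:
  assumes "(\<mu>, V, h) \<in> CE K p \<mu>0 \<mu>1"
  shows "energy_density \<mu> V h \<in> borel_measurable (lebesgue_on {0..1})"
  unfolding energy_density_def[abs_def] using CE_D(6)[OF assms] measurable_CE_flux_action[OF assms]
  by (intro borel_measurable_add borel_measurable_times_ennreal) auto

lemma E_Quad_eq_integral:
  assumes "(\<mu>, V, h) \<in> CE K p \<mu>0 \<mu>1"
  shows "E_Quad K w a b \<mu> V h = (\<integral>\<^sup>+t. energy_density \<mu> V h t \<partial>lebesgue_on {0..1})"
  unfolding E_Quad_def energy_density_def using CE_D(6)[OF assms] measurable_CE_flux_action[OF assms]
  by (simp add: nn_integral_add nn_integral_cmult)

lemma energy_density_eq_0:
  assumes "energy_density \<mu> V h t = 0"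
  shows "h t = 0" "flux_action K w (\<mu> t) (V t) = 0"
  using assms a_pos b_pos by (auto simp: energy_density_def ennreal_eq_0_iff)

text \<open>
  Without source and flux the derivative vanishes at almost every time, and an absolutely continuous function with this property is
  constant.
\<close>

lemma zero_energy_constant:
  assumes CE: "(\<mu>, V, h) \<in> CE K p \<mu>0 \<mu>1" and zero: "E_Quad K w a b \<mu> V h = 0"
  shows "\<mu>0 = \<mu>1"
proof
  fix x
  note D = CE_D[OF CE]
  have "AE t in lebesgue_on {0..1}. energy_density \<mu> V h t = 0"
    using zero unfolding E_Quad_eq_integral[OF CE] using measurable_energy_density[OF CE] by (simp add: nn_integral_0_iff_AE)
  with D(7) AE_space have "AE t in lebesgue_on {0..1}. ((\<lambda>s. \<mu> s x) has_real_derivative 0) (at t within {0..1})"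
  proof eventually_elim
    case (elim t)
    have "discrete_div K (V t) x = 0"
      using flux_action_eq_0[OF energy_density_eq_0(2)[OF elim(3)]] K_pos_commute w_pos D(1) elim(2)
      by (intro discrete_div_eq_0) auto
    then show ?case using elim(1) energy_density_eq_0(1)[OF elim(3)] by (metis diff_self mult_zero_left)
  qed
  then obtain N where N: "negligible N" "\<And>t. t \<in> {0..1} - N \<Longrightarrow> ((\<lambda>s. \<mu> s x) has_real_derivative 0) (at t within {0..1})"
    by (subst (asm) AE_lebesgue_on_iff_negligible) auto
  have "((\<lambda>_. 0) has_integral \<mu> 1 x - \<mu> 0 x) {0..1::real}"
    by (rule abs_continuous_has_integral[where f' = "\<lambda>_. 0", OF D(2) _ _ _ N(1)]) (use N(2) in auto)
  then have "\<mu> 1 x - \<mu> 0 x = 0" using has_integral_unique has_integral_0 by blast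
  then show "\<mu>0 x = \<mu>1 x" using D(3,4) by simp
qed

definition mass :: "(real \<Rightarrow> 'a \<Rightarrow> real) \<Rightarrow> real \<Rightarrow> real" where
  "mass \<mu> t = (\<Sum>x\<in>UNIV. \<mu> t x * w x)"

text \<open>
  The divergence does not contribute to the change of the total mass, and \<open>p\<close> has mass one.
\<close>

lemma rate_of_mass: "(\<Sum>x\<in>UNIV. (r * p x - discrete_div K U x) * w x) = r"
proof -
  have "(\<Sum>x\<in>UNIV. (r * p x - discrete_div K U x) * w x)
      = r * (\<Sum>x\<in>UNIV. p x * w x) - (\<Sum>x\<in>UNIV. discrete_div K U x * w x)"
    by (simp add: left_diff_distrib sum_subtractf sum_distrib_left mult.assoc)
  then show ?thesis by (simp add: p_mass sum_discrete_div)
qed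

lemma mass_derivative:
  assumes "\<And>x. ((\<lambda>s. \<mu> s x) has_real_derivative r * p x - discrete_div K U x) (at t within S)"
  shows "(mass \<mu> has_real_derivative r) (at t within S)"
proof -
  have "((\<lambda>s. \<Sum>x\<in>UNIV. \<mu> s x * w x) has_real_derivative (\<Sum>x\<in>UNIV. (r * p x - discrete_div K U x) * w x)) (at t within S)"
    by (intro DERIV_sum DERIV_cmult_right assms)
  then show ?thesis unfolding rate_of_mass by (simp add: mass_def[abs_def])
qed

lemma mass_has_integral:
  assumes CE: "(\<mu>, V, h) \<in> CE K p \<mu>0 \<mu>1" and uv: "0 \<le> u" "u \<le> v" "v \<le> 1"
  shows "(h has_integral mass \<mu> v - mass \<mu> u) {u..v}"
proof -
  note D = CE_D[OF CE]
  obtain N where N: "negligible N" "\<And>t x. t \<in> {0..1} - N \<Longrightarrow>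
      ((\<lambda>s. \<mu> s x) has_real_derivative h t * p x - discrete_div K (V t) x) (at t within {0..1})"
    using D(7) by (subst (asm) AE_lebesgue_on_iff_negligible) auto
  have "((\<lambda>t. h t * p x - discrete_div K (V t) x) has_integral \<mu> v x - \<mu> u x) {u..v}" for x
    by (rule abs_continuous_has_integral[OF D(2) uv N(1)]) (use N(2) uv in auto)
  then have "((\<lambda>t. \<Sum>x\<in>UNIV. (h t * p x - discrete_div K (V t) x) * w x) has_integral (\<Sum>x\<in>UNIV. (\<mu> v x - \<mu> u x) * w x)) {u..v}"
    by (intro has_integral_sum has_integral_mult_left) auto
  then show ?thesis
    unfolding rate_of_mass by (simp add: mass_def left_diff_distrib sum_subtractf)
qed

end

section \<open>Two-speed reparametrisation of time\<close>

text \<open>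
  The piecewise linear time change that maps \<open>[0, s]\<close> onto \<open>[0, c]\<close> and \<open>[s, 1]\<close> onto \<open>[c, 1]\<close>.
\<close>

definition two_speed :: "real \<Rightarrow> real \<Rightarrow> real \<Rightarrow> real" where
  "two_speed s c t = (if t \<le> s then c / s * t else 1 - (1 - c) / (1 - s) * (1 - t))"

definition two_speed_rate :: "real \<Rightarrow> real \<Rightarrow> real \<Rightarrow> real" where
  "two_speed_rate s c t = (if t \<le> s then c / s else (1 - c) / (1 - s))"

lemma affine_measurable_lebesgue: "v \<noteq> 0 \<Longrightarrow> (\<lambda>t::real. u + v * t) \<in> lebesgue \<rightarrow>\<^sub>M lebesgue"
  using lebesgue_affine_measurable[of "\<lambda>_. v" u] by simp

lemma two_speed_alt: "two_speed s c t = (if t \<le> s then 0 + c / s * t else (1 - (1 - c) / (1 - s)) + (1 - c) / (1 - s) * t)"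
  by (simp add: two_speed_def right_diff_distrib)

context
  fixes s c :: real
  assumes s: "0 < s" "s < 1" and c: "0 < c" "c < 1"
begin

lemma two_speed_endpoints: "two_speed s c 0 = 0" "two_speed s c 1 = 1"
  using s c by (auto simp: two_speed_def)

lemma two_speed_left: "t \<le> s \<Longrightarrow> two_speed s c t \<le> c" "t < s \<Longrightarrow> two_speed s c t < c"
  using s c by (auto simp: two_speed_def field_simps)

lemma two_speed_right: "s < t \<Longrightarrow> c < two_speed s c t"
proof -
  assume "s < t"
  then have "(1 - c) * (1 - t) < (1 - c) * (1 - s)" using c by simp
  then have "(1 - c) / (1 - s) * (1 - t) < 1 - c" using s by (simp add: pos_divide_less_eq)
  then show ?thesis using \<open>s < t\<close> by (simp add: two_speed_def)
qed

lemma two_speed_strict_mono: "strict_mono_on A (two_speed s c)"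
proof (rule strict_mono_onI)
  fix x y :: real assume "x < y"
  consider "y \<le> s" | "x \<le> s" "s < y" | "s < x" by linarith
  then show "two_speed s c x < two_speed s c y"
  proof cases
    case 1 then show ?thesis using \<open>x < y\<close> s c by (simp add: two_speed_def divide_strict_right_mono)
  next
    case 2 then show ?thesis using two_speed_left(1)[of x] two_speed_right[of y] by linarith
  next
    case 3 then show ?thesis using \<open>x < y\<close> s c by (simp add: two_speed_def divide_strict_right_mono)
  qed
qed

lemma two_speed_range: "t \<in> {0..1} \<Longrightarrow> two_speed s c t \<in> {0..1}"
  using strict_mono_onD[OF two_speed_strict_mono[of UNIV], of 0 t] strict_mono_onD[OF two_speed_strict_mono[of UNIV], of t 1]
    two_speed_endpoints by (cases "t = 0"; cases "t = 1") auto

lemma two_speed_lipschitz: "\<bar>two_speed s c x - two_speed s c y\<bar> \<le> max (c / s) ((1 - c) / (1 - s)) * \<bar>x - y\<bar>"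
proof -
  let ?L = "max (c / s) ((1 - c) / (1 - s))"
  have *: "two_speed s c y - two_speed s c x \<le> ?L * (y - x)" if "x \<le> y" for x y
  proof -
    consider "y \<le> s" | "x \<le> s" "s < y" | "s < x" by linarith
    then show ?thesis
    proof cases
      case 1
      then have "two_speed s c y - two_speed s c x = c / s * (y - x)"
        using that by (simp add: two_speed_def right_diff_distrib)
      also have "\<dots> \<le> ?L * (y - x)" using that by (intro mult_right_mono) auto
      finally show ?thesis .
    next
      case 2
      have "two_speed s c y - two_speed s c x = (1 - c) / (1 - s) * (y - s) + c / s * (s - x)"
      proof -
        have "(1 - c) / (1 - s) * (1 - y) = (1 - c) - (1 - c) / (1 - s) * (y - s)" "c / s * (s - x) = c - c / s * x"
          using s by (simp_all add: field_simps)
        then show ?thesis using 2 by (simp add: two_speed_def)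
      qed
      also have "\<dots> \<le> ?L * (y - s) + ?L * (s - x)"
        using 2 by (intro add_mono mult_right_mono) auto
      also have "\<dots> = ?L * (y - x)" by (simp add: algebra_simps)
      finally show ?thesis .
    next
      case 3
      then have "two_speed s c y - two_speed s c x = (1 - c) / (1 - s) * (y - x)"
        using that unfolding two_speed_alt by (simp add: right_diff_distrib)
      also have "\<dots> \<le> ?L * (y - x)" using that by (intro mult_right_mono) auto
      finally show ?thesis .
    qed
  qed
  have mono: "two_speed s c x \<le> two_speed s c y" if "x \<le> y" for x y
    using strict_mono_onD[OF two_speed_strict_mono[of UNIV], of x y] that by (cases "x = y") auto
  show ?thesis using *[of x y] *[of y x] mono[of x y] mono[of y x] by (cases "x \<le> y") auto
qed

lemma two_speed_has_derivative:
  assumes "t \<noteq> s"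
  shows "(two_speed s c has_real_derivative two_speed_rate s c t) (at t within S)"
proof -
  have "(two_speed s c has_real_derivative two_speed_rate s c t) (at t)"
  proof (cases "t < s")
    case True
    have "((\<lambda>t. c / s * t) has_real_derivative c / s) (at t)"
      using s by (auto intro!: derivative_eq_intros)
    then show ?thesis
      using True by (auto intro: has_field_derivative_transform_within_open[of _ _ t "{..<s}"]
          simp: two_speed_def two_speed_rate_def)
  next
    case False
    have "((\<lambda>t. 1 - r * (1 - t)) has_real_derivative r) (at t)" for r :: real
      by (auto intro!: derivative_eq_intros)
    from this[of "(1 - c) / (1 - s)"] show ?thesis
      using False assms by (auto intro: has_field_derivative_transform_within_open[of _ _ t "{s<..}"]
          simp: two_speed_def two_speed_rate_def)
  qed
  then show ?thesis by (rule has_field_derivative_at_within)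
qed

lemma two_speed_preimage_negligible:
  assumes "negligible N"
  shows "negligible {t. two_speed s c t \<in> N}"
proof -
  have aff: "negligible {t. u + v * t \<in> N}" if "v \<noteq> 0" for u v :: real
  proof -
    have "negligible ((\<lambda>y. (y - u) / v) ` N)"
      by (rule negligible_differentiable_image_negligible[OF _ assms])
        (auto simp: divide_inverse intro!: derivative_intros)
    moreover have "{t. u + v * t \<in> N} \<subseteq> (\<lambda>y. (y - u) / v) ` N"
    proof
      fix t assume "t \<in> {t. u + v * t \<in> N}"
      then show "t \<in> (\<lambda>y. (y - u) / v) ` N"
        using that by (intro image_eqI[of _ _ "u + v * t"]) auto
    qed
    ultimately show ?thesis by (rule negligible_subset)
  qed
  have "{t. two_speed s c t \<in> N} \<subseteq> {t. 0 + c / s * t \<in> N} \<union> {t. (1 - (1 - c) / (1 - s)) + (1 - c) / (1 - s) * t \<in> N}"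
    unfolding two_speed_alt by auto
  moreover have "c / s \<noteq> 0" "(1 - c) / (1 - s) \<noteq> 0" using s c by auto
  ultimately show ?thesis using aff negligible_Un negligible_subset by meson
qed

lemma measurable_two_speed: "two_speed s c \<in> lebesgue_on {0..1} \<rightarrow>\<^sub>M lebesgue_on {0..1}"
proof (rule measurable_restrict_space2)
  show "two_speed s c \<in> space (lebesgue_on {0..1}) \<rightarrow> {0..1}"
    using two_speed_range by simp
  have "c / s \<noteq> 0" "(1 - c) / (1 - s) \<noteq> 0" using s c by auto
  then have "(\<lambda>t. if t \<le> s then 0 + c / s * t else (1 - (1 - c) / (1 - s)) + (1 - c) / (1 - s) * t) \<in> lebesgue \<rightarrow>\<^sub>M lebesgue"
    by (intro measurable_If affine_measurable_lebesgue) auto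
  then show "two_speed s c \<in> lebesgue_on {0..1} \<rightarrow>\<^sub>M lebesgue"
    unfolding two_speed_alt[abs_def] by (rule measurable_restrict_space1)
qed

lemma measurable_two_speed_rate: "two_speed_rate s c \<in> borel_measurable (lebesgue_on {0..1})"
proof -
  have "two_speed_rate s c \<in> borel_measurable lebesgue"
    unfolding two_speed_rate_def[abs_def] by (intro measurable_If) auto
  then show ?thesis by (rule measurable_restrict_space1)
qed

text \<open>
  Energies are quadratic in the speed. One factor of the squared rate is absorbed by the substitution, and the other one remains.
\<close>

lemma nn_integral_two_speed:
  assumes e: "e \<in> borel_measurable (lebesgue_on {0..1})"
  shows "(\<integral>\<^sup>+t. ennreal ((two_speed_rate s c t)\<^sup>2) * e (two_speed s c t) \<partial>lebesgue_on {0..1})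
     = ennreal (c / s) * (\<integral>\<^sup>+t. e t * indicator {0..c} t \<partial>lebesgue_on {0..1})
       + ennreal ((1 - c) / (1 - s)) * (\<integral>\<^sup>+t. e t * indicator {c<..1} t \<partial>lebesgue_on {0..1})"
proof -
  define e0 where "e0 = (\<lambda>t. e t * indicator {0..1} t)"
  define e1 where "e1 = (\<lambda>t. e0 t * indicator {0..c} t)"
  define e2 where "e2 = (\<lambda>t. e0 t * indicator {c<..1} t)"
  define l where "l = c / s"
  define r where "r = (1 - c) / (1 - s)"
  have lr: "0 < l" "0 < r" "l \<noteq> 0" "r \<noteq> 0" using s c by (auto simp: l_def r_def)
  have e0: "e0 \<in> borel_measurable lebesgue"
    using e unfolding e0_def by (simp add: borel_measurable_restrict_space_iff_ennreal)
  have me: "e1 \<in> borel_measurable lebesgue" "e2 \<in> borel_measurable lebesgue"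
    unfolding e1_def e2_def using e0 by (auto intro!: borel_measurable_times_ennreal borel_measurable_indicator)
  have me': "(\<lambda>t. e1 (0 + l * t)) \<in> borel_measurable lebesgue" "(\<lambda>t. e2 ((1 - r) + r * t)) \<in> borel_measurable lebesgue"
    by (rule measurable_compose[OF affine_measurable_lebesgue me(1)], simp add: lr)
      (rule measurable_compose[OF affine_measurable_lebesgue me(2)], simp add: lr)
  have "(\<integral>\<^sup>+t. ennreal ((two_speed_rate s c t)\<^sup>2) * e (two_speed s c t) \<partial>lebesgue_on {0..1})
    = (\<integral>\<^sup>+t. ennreal ((two_speed_rate s c t)\<^sup>2) * e (two_speed s c t) * indicator {0..1} t \<partial>lebesgue)"
    by (simp add: nn_integral_restrict_space)
  also have "\<dots> = (\<integral>\<^sup>+t. ennreal (l\<^sup>2) * e1 (0 + l * t) + ennreal (r\<^sup>2) * e2 ((1 - r) + r * t) \<partial>lebesgue)"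
  proof (rule nn_integral_cong)
    fix t :: real
    have sp: "two_speed s c t = (if t \<le> s then 0 + l * t else (1 - r) + r * t)"
      unfolding two_speed_alt l_def r_def ..
    have rate: "two_speed_rate s c t = (if t \<le> s then l else r)"
      unfolding two_speed_rate_def l_def r_def ..
    have strict: "two_speed s c x < two_speed s c y \<longleftrightarrow> x < y" for x y
      using strict_mono_on_less[OF two_speed_strict_mono[of UNIV]] by simp
    have in01: "two_speed s c t \<in> {0..1} \<longleftrightarrow> t \<in> {0..1}"
      using strict[of t 0] strict[of 1 t] two_speed_endpoints by (auto simp: not_less[symmetric])
    have ls: "l * s = c" using s by (simp add: l_def)
    have "r * (1 - s) = 1 - c" using s by (simp add: r_def)
    then have rs: "(1 - r) + r * s = c" by (simp add: algebra_simps)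
    show "ennreal ((two_speed_rate s c t)\<^sup>2) * e (two_speed s c t) * indicator {0..1} t
        = ennreal (l\<^sup>2) * e1 (0 + l * t) + ennreal (r\<^sup>2) * e2 ((1 - r) + r * t)"
    proof (cases "t \<le> s")
      case True
      then have "r * t \<le> r * s" "l * t \<le> l * s" using lr by auto
      then have "e2 ((1 - r) + r * t) = 0" "l * t \<le> c" using rs ls by (auto simp: e2_def indicator_def)
      then show ?thesis using True in01 sp rate c by (auto simp: e1_def e0_def indicator_def)
    next
      case False
      then have "l * s < l * t" "r * s < r * t" using lr by auto
      then have "e1 (0 + l * t) = 0" "c < (1 - r) + r * t" using ls rs by (auto simp: e1_def indicator_def)
      then show ?thesis using False in01 sp rate c by (auto simp: e2_def e0_def indicator_def)
    qed
  qed
  also have "\<dots> = ennreal (l\<^sup>2) * (\<integral>\<^sup>+t. e1 (0 + l * t) \<partial>lebesgue) + ennreal (r\<^sup>2) * (\<integral>\<^sup>+t. e2 ((1 - r) + r * t) \<partial>lebesgue)"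
    using me' by (simp add: nn_integral_add nn_integral_cmult)
  also have "ennreal (l\<^sup>2) * (\<integral>\<^sup>+t. e1 (0 + l * t) \<partial>lebesgue) = ennreal l * (\<integral>\<^sup>+t. e1 t \<partial>lebesgue)"
    using nn_integral_real_affine_lebesgue[OF me(1) lr(3), of 0] lr
    by (simp add: power2_eq_square ennreal_mult mult.assoc)
  also have "ennreal (r\<^sup>2) * (\<integral>\<^sup>+t. e2 ((1 - r) + r * t) \<partial>lebesgue) = ennreal r * (\<integral>\<^sup>+t. e2 t \<partial>lebesgue)"
    using nn_integral_real_affine_lebesgue[OF me(2) lr(4), of "1 - r"] lr
    by (simp add: power2_eq_square ennreal_mult mult.assoc)
  also have "(\<integral>\<^sup>+t. e1 t \<partial>lebesgue) = (\<integral>\<^sup>+t. e t * indicator {0..c} t \<partial>lebesgue_on {0..1})"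
    by (simp add: nn_integral_restrict_space e1_def e0_def mult.assoc mult.commute[of "indicator {0..1} _"])
  also have "(\<integral>\<^sup>+t. e2 t \<partial>lebesgue) = (\<integral>\<^sup>+t. e t * indicator {c<..1} t \<partial>lebesgue_on {0..1})"
    by (simp add: nn_integral_restrict_space e2_def e0_def mult.assoc mult.commute[of "indicator {0..1} _"])
  finally show ?thesis by (simp add: l_def r_def)
qed

lemma CE_two_speed:
  assumes CE: "(\<mu>, V, h) \<in> CE K p \<mu>0 \<mu>1"
  shows "(\<lambda>t. \<mu> (two_speed s c t), \<lambda>t x y. two_speed_rate s c t * V (two_speed s c t) x y,
     \<lambda>t. two_speed_rate s c t * h (two_speed s c t)) \<in> CE K p \<mu>0 \<mu>1"
proof -
  note D = CE_D[OF CE]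
  have "abs_continuous_on_interval 0 1 (\<lambda>t. \<mu> (two_speed s c t) x)" for x
    using abs_continuous_compose_strict_mono[OF D(2) two_speed_strict_mono _ two_speed_lipschitz] two_speed_range by blast
  moreover have "\<mu> (two_speed s c t) \<in> densities" if "t \<in> {0..1}" for t
    using D(1) two_speed_range[OF that] by (simp add: densities_def)
  moreover have "(\<lambda>t. two_speed_rate s c t * V (two_speed s c t) x y) \<in> borel_measurable (lebesgue_on {0..1})" for x y
    using measurable_compose[OF measurable_two_speed D(5)] measurable_two_speed_rate by (rule borel_measurable_times[rotated])
  moreover have "(\<lambda>t. two_speed_rate s c t * h (two_speed s c t)) \<in> borel_measurable (lebesgue_on {0..1})"
    using measurable_compose[OF measurable_two_speed D(6)] measurable_two_speed_rate by (rule borel_measurable_times[rotated])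
  moreover have "AE t in lebesgue_on {0..1}. \<forall>x. ((\<lambda>t. \<mu> (two_speed s c t) x) has_real_derivative
      two_speed_rate s c t * h (two_speed s c t) * p x
      - discrete_div K (\<lambda>x y. two_speed_rate s c t * V (two_speed s c t) x y) x) (at t within {0..1})"
  proof -
    obtain N where N: "negligible N" "\<And>t x. t \<in> {0..1} - N \<Longrightarrow>
        ((\<lambda>s. \<mu> s x) has_real_derivative h t * p x - discrete_div K (V t) x) (at t within {0..1})"
      using D(7) by (subst (asm) AE_lebesgue_on_iff_negligible) auto
    show ?thesis
    proof (subst AE_lebesgue_on_iff_negligible, simp, intro exI conjI ballI allI)
      show "negligible ({t. two_speed s c t \<in> N} \<union> {s})"
        using two_speed_preimage_negligible[OF N(1)] by simp
      fix t x assume t: "t \<in> {0..1} - ({t. two_speed s c t \<in> N} \<union> {s})"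
      then have "two_speed s c t \<in> {0..1} - N" "t \<noteq> s" using two_speed_range by auto
      have "((\<lambda>s. \<mu> s x) has_real_derivative h (two_speed s c t) * p x - discrete_div K (V (two_speed s c t)) x)
        (at (two_speed s c t) within two_speed s c ` {0..1})"
        by (rule DERIV_subset[OF N(2)[OF \<open>two_speed s c t \<in> {0..1} - N\<close>]]) (use two_speed_range in auto)
      from DERIV_image_chain[OF this two_speed_has_derivative[OF \<open>t \<noteq> s\<close>]]
      show "((\<lambda>t. \<mu> (two_speed s c t) x) has_real_derivative
        two_speed_rate s c t * h (two_speed s c t) * p x
        - discrete_div K (\<lambda>x y. two_speed_rate s c t * V (two_speed s c t) x y) x) (at t within {0..1})"
        by (simp add: o_def discrete_div_scale algebra_simps)
    qed
  qed
  ultimately show ?thesis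
    using D(3,4) two_speed_endpoints by (auto simp: CE_def ac_curve_between_def)
qed

end

section \<open>Tent functions\<close>

text \<open>
  The piecewise linear function with value 0 outside \<open>(s, t)\<close> and value 1 at \<open>m\<close>.
\<close>

definition tent :: "real \<Rightarrow> real \<Rightarrow> real \<Rightarrow> real \<Rightarrow> real" where
  "tent s m t \<tau> = max 0 (min ((\<tau> - s) / (m - s)) ((t - \<tau>) / (t - m)))"

definition tent_slope :: "real \<Rightarrow> real \<Rightarrow> real \<Rightarrow> real \<Rightarrow> real" where
  "tent_slope s m t \<tau> = (if \<tau> < s \<or> t < \<tau> then 0 else if \<tau> < m then 1 / (m - s) else - 1 / (t - m))"

lemma tent_nonneg: "0 \<le> tent s m t \<tau>"
  by (simp add: tent_def)

lemma tent_slope_measurable: "tent_slope s m t \<in> borel_measurable (lebesgue_on S)"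
proof -
  have "tent_slope s m t \<in> borel_measurable borel"
    unfolding tent_slope_def[abs_def] by measurable
  then show ?thesis by (intro measurable_restrict_space1 measurable_completion) simp
qed

context
  fixes s m t :: real
  assumes order: "s < m" "m < t"
begin

lemma tent_outside: "\<tau> \<le> s \<Longrightarrow> tent s m t \<tau> = 0" "t \<le> \<tau> \<Longrightarrow> tent s m t \<tau> = 0"
  using order by (auto simp: tent_def divide_nonpos_pos min_le_iff_disj intro!: max_absorb1)

lemma tent_left: "s \<le> \<tau> \<Longrightarrow> \<tau> \<le> m \<Longrightarrow> tent s m t \<tau> = (\<tau> - s) / (m - s)"
proof -
  assume "s \<le> \<tau>" "\<tau> \<le> m"
  then have "0 \<le> (\<tau> - s) / (m - s)" "(\<tau> - s) / (m - s) \<le> 1" "1 \<le> (t - \<tau>) / (t - m)"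
    using order by (simp_all add: le_divide_eq)
  then show ?thesis by (simp add: tent_def)
qed

lemma tent_right: "m \<le> \<tau> \<Longrightarrow> \<tau> \<le> t \<Longrightarrow> tent s m t \<tau> = (t - \<tau>) / (t - m)"
proof -
  assume "m \<le> \<tau>" "\<tau> \<le> t"
  then have "0 \<le> (t - \<tau>) / (t - m)" "(t - \<tau>) / (t - m) \<le> 1" "1 \<le> (\<tau> - s) / (m - s)"
    using order by (simp_all add: le_divide_eq)
  then show ?thesis by (simp add: tent_def)
qed

lemma tent_pos: "s < \<tau> \<Longrightarrow> \<tau> < t \<Longrightarrow> 0 < tent s m t \<tau>"
  using order by (simp add: tent_def)

lemma tent_abs_continuous: "abs_continuous_on_interval l r (tent s m t)"
proof (rule abs_continuous_lipschitz)
  fix x y :: real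
  have lip: "\<bar>max 0 (min u v) - max 0 (min u' v')\<bar> \<le> \<bar>u - u'\<bar> + \<bar>v - v'\<bar>" for u v u' v' :: real
    by (auto simp: max_def min_def)
  have "(x - s) / (m - s) - (y - s) / (m - s) = (x - y) / (m - s)" "(t - x) / (t - m) - (t - y) / (t - m) = (y - x) / (t - m)"
    by (simp_all flip: diff_divide_distrib)
  then have "\<bar>tent s m t x - tent s m t y\<bar> \<le> \<bar>(x - y) / (m - s)\<bar> + \<bar>(y - x) / (t - m)\<bar>"
    using lip[of "(x - s) / (m - s)" "(t - x) / (t - m)" "(y - s) / (m - s)" "(t - y) / (t - m)"]
    by (simp add: tent_def)
  also have "\<dots> = (1 / (m - s) + 1 / (t - m)) * \<bar>x - y\<bar>"
    using order by (simp add: abs_divide abs_minus_commute distrib_right)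
  finally show "\<bar>tent s m t x - tent s m t y\<bar> \<le> (1 / (m - s) + 1 / (t - m)) * \<bar>x - y\<bar>" .
qed

lemma tent_has_derivative:
  assumes "\<tau> \<notin> {s, m, t}"
  shows "(tent s m t has_real_derivative tent_slope s m t \<tau>) (at \<tau> within S)"
proof -
  have "(tent s m t has_real_derivative tent_slope s m t \<tau>) (at \<tau>)"
  proof -
    consider "\<tau> < s" | "s < \<tau>" "\<tau> < m" | "m < \<tau>" "\<tau> < t" | "t < \<tau>" using assms by force
    then show ?thesis
    proof cases
      case 1
      show ?thesis
        by (rule has_field_derivative_transform_within_open[where f = "\<lambda>_. 0" and S = "{..<s}"])
          (use 1 tent_outside in \<open>auto simp: tent_slope_def\<close>)
    next
      case 2
      have "((\<lambda>\<tau>. (\<tau> - s) / (m - s)) has_real_derivative 1 / (m - s)) (at \<tau>)"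
        using order by (auto intro!: derivative_eq_intros)
      moreover have "tent_slope s m t \<tau> = 1 / (m - s)" using 2 order by (simp add: tent_slope_def)
      ultimately show ?thesis
        using 2 order tent_left
        by (auto intro: has_field_derivative_transform_within_open[where S = "{s<..<m}"])
    next
      case 3
      have "((\<lambda>\<tau>. (t - \<tau>) / (t - m)) has_real_derivative - 1 / (t - m)) (at \<tau>)"
        by (rule DERIV_cdivide) (auto intro!: derivative_eq_intros)
      moreover have "tent_slope s m t \<tau> = - 1 / (t - m)" using 3 order by (simp add: tent_slope_def)
      ultimately show ?thesis
        using 3 order tent_right
        by (auto intro: has_field_derivative_transform_within_open[where S = "{m<..<t}"])
    next
      case 4
      show ?thesis
        by (rule has_field_derivative_transform_within_open[where f = "\<lambda>_. 0" and S = "{t<..}"])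
          (use 4 order tent_outside in \<open>auto simp: tent_slope_def\<close>)
    qed
  qed
  then show ?thesis by (rule has_field_derivative_at_within)
qed

lemma tent_has_derivative_AE:
  "AE \<tau> in lebesgue_on {0..1}. (tent s m t has_real_derivative tent_slope s m t \<tau>) (at \<tau> within {0..1})"
proof (rule eventually_mono)
  show "AE \<tau> in lebesgue_on {0..1}. \<tau> \<notin> {s, m, t}"
    by (rule AE_lebesgue_on_negligible) auto
qed (rule tent_has_derivative)

lemma tent_slope_bounded: "\<bar>tent_slope s m t \<tau>\<bar> \<le> 1 / (m - s) + 1 / (t - m)"
  using order by (auto simp: tent_slope_def)

end

section \<open>Variations of an optimal curve\<close>

context transport_setting
begin

text \<open>
  If \<open>F\<close> and \<open>R\<close> are the energies spent on \<open>[0, c]\<close> and \<open>[c, 1]\<close>, then a two-speed change of time turns the energy into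
  \<open>(c/s) F + ((1-c)/(1-s)) R\<close>. By optimality this function of \<open>s\<close> is minimal at \<open>s = c\<close>, and its derivative there
  vanishes exactly if \<open>F = c (F + R)\<close>.
\<close>

lemma optimal_constant_speed:
  assumes CE: "(\<mu>, V, h) \<in> CE K p \<mu>0 \<mu>1"
    and opt: "E_Quad K w a b \<mu> V h = W_squared K w p a b \<mu>0 \<mu>1"
    and fin: "E_Quad K w a b \<mu> V h < \<infinity>"
    and c: "0 < c" "c < 1"
  shows "(\<integral>\<^sup>+t. energy_density \<mu> V h t * indicator {0..c} t \<partial>lebesgue_on {0..1}) = ennreal c * E_Quad K w a b \<mu> V h"
proof -
  let ?M = "lebesgue_on {0..1::real}"
  let ?e = "energy_density \<mu> V h"
  let ?F = "\<integral>\<^sup>+t. ?e t * indicator {0..c} t \<partial>?M"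
  let ?R = "\<integral>\<^sup>+t. ?e t * indicator {c<..1} t \<partial>?M"
  note e = measurable_energy_density[OF CE]
  have "(\<integral>\<^sup>+t. ?e t \<partial>?M) = (\<integral>\<^sup>+t. ?e t * indicator {0..c} t + ?e t * indicator {c<..1} t \<partial>?M)"
    using c by (intro nn_integral_cong) (auto simp: indicator_def)
  also have "\<dots> = ?F + ?R"
    by (intro nn_integral_add borel_measurable_times_ennreal borel_measurable_indicator e)
      (use c in \<open>auto simp: sets_restrict_space_iff\<close>)
  finally have split: "E_Quad K w a b \<mu> V h = ?F + ?R"
    using E_Quad_eq_integral[OF CE] by simp
  then obtain F R where FR: "?F = ennreal F" "0 \<le> F" "?R = ennreal R" "0 \<le> R"
    using fin by (cases ?F; cases ?R) auto
  have ineq: "F + R \<le> c / s * F + (1 - c) / (1 - s) * R" if s: "0 < s" "s < 1" for s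
  proof -
    let ?\<sigma> = "two_speed s c" and ?r = "two_speed_rate s c"
    note CE' = CE_two_speed[OF s c CE]
    have "ennreal (F + R) = E_Quad K w a b \<mu> V h"
      using split FR by simp
    also have "\<dots> \<le> E_Quad K w a b (\<lambda>t. \<mu> (?\<sigma> t)) (\<lambda>t x y. ?r t * V (?\<sigma> t) x y) (\<lambda>t. ?r t * h (?\<sigma> t))"
      unfolding opt by (rule W_squared_le_E_Quad[OF CE'])
    also have "\<dots> = (\<integral>\<^sup>+t. ennreal ((?r t)\<^sup>2) * ?e (?\<sigma> t) \<partial>?M)"
      unfolding E_Quad_eq_integral[OF CE'] 
      by (intro nn_integral_cong)
        (simp add: energy_density_def flux_action_scale_flux abs_mult power_mult_distrib ennreal_mult distrib_left mult.left_commute)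
    also have "\<dots> = ennreal (c / s * F + (1 - c) / (1 - s) * R)"
      unfolding nn_integral_two_speed[OF s c e] FR(1,3)
      using s c FR by (simp add: ennreal_mult'[symmetric] ennreal_plus[symmetric] del: ennreal_plus)
    finally show ?thesis using FR s c by (subst (asm) ennreal_le_iff) auto
  qed
  have quad: "0 \<le> \<eta> * (c * R - (1 - c) * F) + \<eta>\<^sup>2 * (F + R)" if "0 < c + \<eta>" "c + \<eta> < 1" for \<eta>
  proof -
    let ?s = "c + \<eta>"
    have "(F + R) * (?s * (1 - ?s)) \<le> (c / ?s * F + (1 - c) / (1 - ?s) * R) * (?s * (1 - ?s))"
      using ineq[OF that] that by (intro mult_right_mono) auto
    also have "\<dots> = (c / ?s * ?s) * ((1 - ?s) * F) + ((1 - c) / (1 - ?s) * (1 - ?s)) * (?s * R)"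
    proof -
      have "(u * F + v * R) * (r * (1 - r)) = (u * r) * ((1 - r) * F) + (v * (1 - r)) * (r * R)" for u v r :: real
        by (simp add: algebra_simps)
      then show ?thesis .
    qed
    also have "\<dots> = c * ((1 - ?s) * F) + (1 - c) * (?s * R)" using that by simp
    finally show ?thesis by (simp add: algebra_simps power2_eq_square)
  qed
  define k where "k = c * R - (1 - c) * F"
  have "k = 0"
  proof (rule ccontr)
    assume "k \<noteq> 0"
    define E where "E = F + R"
    have E0: "0 \<le> E" using FR by (simp add: E_def)
    \<comment> \<open>The step keeps the break point inside the unit interval and the linear term dominant over the quadratic one.\<close>
    define q where "q = min (min (c / 2) ((1 - c) / 2)) (\<bar>k\<bar> / (2 * (E + 1)))"
    have "0 < \<bar>k\<bar> / (2 * (E + 1))" using \<open>k \<noteq> 0\<close> E0 by simp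
    then have "0 < q" using c unfolding q_def min_less_iff_conj by simp
    moreover have "q \<le> min (c / 2) ((1 - c) / 2)" "q \<le> \<bar>k\<bar> / (2 * (E + 1))"
      unfolding q_def by (rule min.cobounded1, rule min.cobounded2)
    ultimately have q: "0 < q" "q \<le> c / 2" "q \<le> (1 - c) / 2" "q \<le> \<bar>k\<bar> / (2 * (E + 1))" by simp_all
    define \<eta> where "\<eta> = - sgn k * q"
    have "\<bar>\<eta>\<bar> = q" "\<eta> * k = - (q * \<bar>k\<bar>)" "\<eta>\<^sup>2 = q * q"
      using \<open>k \<noteq> 0\<close> q by (auto simp: \<eta>_def sgn_if power2_eq_square)
    then have "0 \<le> - (q * \<bar>k\<bar>) + q * q * E"
      using quad[of \<eta>] q c by (auto simp: k_def E_def)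
    then have "q * \<bar>k\<bar> \<le> q * (q * E)" by (simp add: mult.assoc)
    then have "\<bar>k\<bar> \<le> q * E" using q(1) by (simp add: mult_le_cancel_left)
    moreover have "q * (2 * (E + 1)) \<le> \<bar>k\<bar>" using q(4) E0 by (simp add: pos_le_divide_eq)
    ultimately have "q * (2 * (E + 1)) \<le> q * E" by linarith
    then have "2 * (E + 1) \<le> E" using q(1) by (simp add: mult_le_cancel_left)
    then show False using E0 by simp
  qed
  then have "F = c * (F + R)" by (simp add: k_def algebra_simps)
  then have "ennreal F = ennreal (c * (F + R))" by simp
  also have "\<dots> = ennreal c * ennreal (F + R)" using c FR by (simp add: ennreal_mult)
  finally show ?thesis using split FR by simp
qed

text \<open>
  The integral of the source against the slope of a tent is the difference of two slopes of the mass. This is how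
  a variation by tents sees the concavity of the mass.
\<close>

lemma mass_tent_integral:
  assumes CE: "(\<mu>, V, h) \<in> CE K p \<mu>0 \<mu>1" and smt: "0 \<le> s" "s < m" "m < t" "t \<le> 1"
  shows "((\<lambda>\<tau>. h \<tau> * tent_slope s m t \<tau>) has_integral
     (mass \<mu> m - mass \<mu> s) / (m - s) - (mass \<mu> t - mass \<mu> m) / (t - m)) {0..1}"
proof -
  have piece: "((\<lambda>\<tau>. h \<tau> * tent_slope s m t \<tau>) has_integral (mass \<mu> v - mass \<mu> u) * k) {u..v}"
    if "0 \<le> u" "u \<le> v" "v \<le> 1" "\<And>\<tau>. u < \<tau> \<Longrightarrow> \<tau> < v \<Longrightarrow> tent_slope s m t \<tau> = k" for u v k
  proof (rule has_integral_spike[of "{u, v}"])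
    show "((\<lambda>\<tau>. h \<tau> * k) has_integral (mass \<mu> v - mass \<mu> u) * k) {u..v}"
      by (intro has_integral_mult_left mass_has_integral[OF CE]) (use that in auto)
  qed (use that in auto)
  let ?f = "\<lambda>\<tau>. h \<tau> * tent_slope s m t \<tau>"
  have "(?f has_integral (mass \<mu> s - mass \<mu> 0) * 0) {0..s}"
    "(?f has_integral (mass \<mu> m - mass \<mu> s) * (1 / (m - s))) {s..m}"
    "(?f has_integral (mass \<mu> t - mass \<mu> m) * (- 1 / (t - m))) {m..t}"
    "(?f has_integral (mass \<mu> 1 - mass \<mu> t) * 0) {t..1}"
    by (rule piece; use smt in \<open>simp add: tent_slope_def\<close>)+
  note parts = this
  note has_integral_combine[OF _ _ has_integral_combine[OF _ _ has_integral_combine[OF _ _ parts(1,2)] parts(3)] parts(4)]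
  then have "(?f has_integral (mass \<mu> s - mass \<mu> 0) * 0 + (mass \<mu> m - mass \<mu> s) * (1 / (m - s))
      + (mass \<mu> t - mass \<mu> m) * (- 1 / (t - m)) + (mass \<mu> 1 - mass \<mu> t) * 0) {0..1}"
    using smt by simp
  then show ?thesis by simp
qed

text \<open>
  Comparing an optimal curve with its variation by \<open>\<epsilon> G p\<close>. The source cost is expanded exactly in \<open>\<epsilon>\<close>, with \<open>I = \<integral> h G'\<close>;
  the action is only compared. The second conclusion follows from the first because the action decreases.
\<close>

lemma optimal_perturbation:
  assumes CE: "(\<mu>, V, h) \<in> CE K p \<mu>0 \<mu>1"
    and opt: "E_Quad K w a b \<mu> V h = W_squared K w p a b \<mu>0 \<mu>1"
    and fin: "E_Quad K w a b \<mu> V h < \<infinity>"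
    and G: "abs_continuous_on_interval 0 1 G" "\<And>t. t \<in> {0..1} \<Longrightarrow> 0 \<le> G t" "G 0 = 0" "G 1 = 0"
    and g: "g \<in> borel_measurable (lebesgue_on {0..1})"
      "AE t in lebesgue_on {0..1}. (G has_real_derivative g t) (at t within {0..1})"
      "\<And>t. \<bar>g t\<bar> \<le> C"
    and hg: "((\<lambda>t. h t * g t) has_integral I) {0..1}"
    and \<epsilon>: "0 \<le> \<epsilon>"
  shows "ennreal (b\<^sup>2) * (\<integral>\<^sup>+t. flux_action K w (\<mu> t) (V t) \<partial>lebesgue_on {0..1})
    \<le> ennreal (a\<^sup>2 * (2 * \<epsilon> * I + \<epsilon>\<^sup>2 * C\<^sup>2))
      + ennreal (b\<^sup>2) * (\<integral>\<^sup>+t. flux_action K w (\<lambda>x. \<mu> t x + \<epsilon> * G t * p x) (V t) \<partial>lebesgue_on {0..1})"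
    "0 \<le> 2 * \<epsilon> * I + \<epsilon>\<^sup>2 * C\<^sup>2"
    "(\<integral>\<^sup>+t. flux_action K w (\<mu> t) (V t) \<partial>lebesgue_on {0..1}) < \<infinity>"
proof -
  note D = CE_D[OF CE]
  let ?M = "lebesgue_on {0..1::real}"
  let ?A = "\<integral>\<^sup>+t. flux_action K w (\<mu> t) (V t) \<partial>?M"
  let ?B = "\<integral>\<^sup>+t. flux_action K w (\<lambda>x. \<mu> t x + \<epsilon> * G t * p x) (V t) \<partial>?M"
  have fin': "(\<integral>\<^sup>+t. ennreal (\<bar>h t\<bar>\<^sup>2) \<partial>?M) < \<infinity>" "?A < \<infinity>"
    using fin a_pos b_pos by (auto simp: E_Quad_def ennreal_mult_less_top)
  then show "?A < \<infinity>" by simp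
  have "?B \<le> ?A"
    using D(1) G(2) \<epsilon> p_pos by (intro nn_integral_mono flux_action_antimono) (auto simp: less_imp_le)
  have h2: "integrable ?M (\<lambda>t. (h t)\<^sup>2)"
    using D(6) fin'(1) by (intro integrableI_nonneg) auto
  have g2C: "(g t)\<^sup>2 \<le> C\<^sup>2" for t
    using power_mono[OF g(3)[of t], of 2] by simp
  have g2: "integrable ?M (\<lambda>t. (g t)\<^sup>2)"
  proof (rule finite_measure.integrable_const_bound[where B = "C\<^sup>2"])
    show "finite_measure ?M" by (rule finite_measure_lebesgue_on) simp
    show "AE t in ?M. norm ((g t)\<^sup>2) \<le> C\<^sup>2" using g2C by simp
  qed (use g(1) in simp)
  have hgi: "integrable ?M (\<lambda>t. h t * g t)"
  proof (rule Bochner_Integration.integrable_bound[OF Bochner_Integration.integrable_add[OF h2 g2]])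
    show "AE t in ?M. norm (h t * g t) \<le> norm ((h t)\<^sup>2 + (g t)\<^sup>2)"
    proof (rule AE_I2)
      fix t
      have "0 \<le> (\<bar>h t\<bar> - \<bar>g t\<bar>)\<^sup>2" by simp
      then have "2 * (\<bar>h t\<bar> * \<bar>g t\<bar>) \<le> (h t)\<^sup>2 + (g t)\<^sup>2" by (simp add: power2_diff algebra_simps)
      then have "\<bar>h t\<bar> * \<bar>g t\<bar> \<le> (h t)\<^sup>2 + (g t)\<^sup>2" using mult_nonneg_nonneg[of "\<bar>h t\<bar>" "\<bar>g t\<bar>"] by linarith
      then show "norm (h t * g t) \<le> norm ((h t)\<^sup>2 + (g t)\<^sup>2)" by (simp add: abs_mult)
    qed
  qed (use D(6) g(1) in auto)
  have I: "(LINT t|?M. h t * g t) = I"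
    using lebesgue_integral_eq_integral[OF hgi] integral_unique[OF hg] by simp
  define H where "H = (LINT t|?M. (h t)\<^sup>2)"
  have H: "(\<integral>\<^sup>+t. ennreal (\<bar>h t\<bar>\<^sup>2) \<partial>?M) = ennreal H" "0 \<le> H"
    unfolding H_def using nn_integral_eq_integral[OF h2] by auto
  have he2: "integrable ?M (\<lambda>t. (h t + \<epsilon> * g t)\<^sup>2)"
    and He: "(LINT t|?M. (h t + \<epsilon> * g t)\<^sup>2) = H + 2 * \<epsilon> * I + \<epsilon>\<^sup>2 * (LINT t|?M. (g t)\<^sup>2)"
  proof -
    have eq: "(h t + \<epsilon> * g t)\<^sup>2 = (h t)\<^sup>2 + 2 * \<epsilon> * (h t * g t) + \<epsilon>\<^sup>2 * (g t)\<^sup>2" for t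
      by (simp add: power2_eq_square algebra_simps)
    show "integrable ?M (\<lambda>t. (h t + \<epsilon> * g t)\<^sup>2)" unfolding eq using h2 g2 hgi by simp
    show "(LINT t|?M. (h t + \<epsilon> * g t)\<^sup>2) = H + 2 * \<epsilon> * I + \<epsilon>\<^sup>2 * (LINT t|?M. (g t)\<^sup>2)"
      unfolding eq H_def using h2 g2 hgi I by simp
  qed
  have G2: "(LINT t|?M. (g t)\<^sup>2) \<le> C\<^sup>2"
  proof -
    have "(LINT t|?M. (g t)\<^sup>2) \<le> (LINT t|?M. C\<^sup>2)"
      using g2 g2C by (intro integral_mono finite_measure.integrable_const finite_measure_lebesgue_on) auto
    then show ?thesis by (simp add: measure_restrict_space)
  qed
  define R where "R = 2 * \<epsilon> * I + \<epsilon>\<^sup>2 * C\<^sup>2"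
  have He_le: "(LINT t|?M. (h t + \<epsilon> * g t)\<^sup>2) \<le> H + R"
    unfolding He R_def using mult_left_mono[OF G2, of "\<epsilon>\<^sup>2"] by simp
  have "0 \<le> (LINT t|?M. (h t + \<epsilon> * g t)\<^sup>2)" by (rule Bochner_Integration.integral_nonneg) simp
  with He_le have HR: "0 \<le> H + R" by linarith
  have "ennreal (a\<^sup>2) * ennreal H + ennreal (b\<^sup>2) * ?A = E_Quad K w a b \<mu> V h"
    unfolding E_Quad_def H(1) ..
  also have "\<dots> \<le> E_Quad K w a b (\<lambda>t x. \<mu> t x + \<epsilon> * G t * p x) V (\<lambda>t. h t + \<epsilon> * g t)"
    unfolding opt by (intro W_squared_le_E_Quad CE_perturb[OF CE _ G g(1,2) \<epsilon>]) (simp add: p_pos less_imp_le)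
  also have "\<dots> = ennreal (a\<^sup>2) * ennreal (LINT t|?M. (h t + \<epsilon> * g t)\<^sup>2) + ennreal (b\<^sup>2) * ?B"
    unfolding E_Quad_def using nn_integral_eq_integral[OF he2] by simp
  also have "\<dots> \<le> ennreal (a\<^sup>2) * ennreal (H + R) + ennreal (b\<^sup>2) * ?B"
    using He_le by (intro add_mono mult_left_mono ennreal_leI) auto
  finally have main: "ennreal (a\<^sup>2) * ennreal H + ennreal (b\<^sup>2) * ?A \<le> ennreal (a\<^sup>2) * ennreal (H + R) + ennreal (b\<^sup>2) * ?B" .
  obtain A0 where A0: "?A = ennreal A0" "0 \<le> A0" using fin'(2) by (cases ?A) auto
  obtain B0 where B0: "?B = ennreal B0" "0 \<le> B0" using \<open>?B \<le> ?A\<close> fin'(2) by (cases ?B) auto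
  have "B0 \<le> A0" using \<open>?B \<le> ?A\<close> A0 B0 by simp
  have "ennreal (a\<^sup>2 * H + b\<^sup>2 * A0) \<le> ennreal (a\<^sup>2 * (H + R) + b\<^sup>2 * B0)"
    using main A0 B0 H(2) HR by (simp add: ennreal_mult[symmetric] ennreal_plus[symmetric] del: ennreal_plus)
  then have real: "b\<^sup>2 * A0 \<le> a\<^sup>2 * R + b\<^sup>2 * B0"
    by (subst (asm) ennreal_le_iff)
      (intro add_nonneg_nonneg mult_nonneg_nonneg zero_le_power2 B0(2) HR, simp add: distrib_left)
  moreover have "b\<^sup>2 * B0 \<le> b\<^sup>2 * A0" using \<open>B0 \<le> A0\<close> by (intro mult_left_mono) auto
  ultimately have "0 \<le> a\<^sup>2 * R" by linarith
  then show R0: "0 \<le> 2 * \<epsilon> * I + \<epsilon>\<^sup>2 * C\<^sup>2" using a_pos by (simp add: R_def zero_le_mult_iff)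
  have "ennreal (b\<^sup>2) * ?A = ennreal (b\<^sup>2 * A0)" "ennreal (b\<^sup>2) * ?B = ennreal (b\<^sup>2 * B0)"
    using A0 B0 by (simp_all add: ennreal_mult)
  moreover have "ennreal (b\<^sup>2 * A0) \<le> ennreal (a\<^sup>2 * R) + ennreal (b\<^sup>2 * B0)"
    using real \<open>0 \<le> a\<^sup>2 * R\<close> B0 by (simp add: ennreal_plus[symmetric] ennreal_leI del: ennreal_plus)
  ultimately show "ennreal (b\<^sup>2) * ?A \<le> ennreal (a\<^sup>2 * (2 * \<epsilon> * I + \<epsilon>\<^sup>2 * C\<^sup>2)) + ennreal (b\<^sup>2) * ?B"
    by (simp add: R_def)
qed

text \<open>
  The variation by a tent changes the source cost at first order by the difference of the two slopes of the mass, so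
  this difference cannot be negative.
\<close>

lemma optimal_mass_concave:
  assumes CE: "(\<mu>, V, h) \<in> CE K p \<mu>0 \<mu>1"
    and opt: "E_Quad K w a b \<mu> V h = W_squared K w p a b \<mu>0 \<mu>1"
    and fin: "E_Quad K w a b \<mu> V h < \<infinity>"
    and smt: "0 \<le> s" "s < m" "m < t" "t \<le> 1"
  shows "(mass \<mu> t - mass \<mu> m) / (t - m) \<le> (mass \<mu> m - mass \<mu> s) / (m - s)"
proof -
  define I where "I = (mass \<mu> m - mass \<mu> s) / (m - s) - (mass \<mu> t - mass \<mu> m) / (t - m)"
  define C where "C = 1 / (m - s) + 1 / (t - m)"
  have AEd: "AE \<tau> in lebesgue_on {0..1}. (tent s m t has_real_derivative tent_slope s m t \<tau>) (at \<tau> within {0..1})"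
    by (rule tent_has_derivative_AE[OF smt(2,3)])
  have "0 \<le> 2 * \<epsilon> * I + \<epsilon>\<^sup>2 * C\<^sup>2" if "0 \<le> \<epsilon>" for \<epsilon>
    by (rule optimal_perturbation(2)[OF CE opt fin tent_abs_continuous[OF smt(2,3)] _ _ _ tent_slope_measurable[of s m t] AEd
          tent_slope_bounded[OF smt(2,3), folded C_def] mass_tent_integral[OF CE smt, folded I_def] that])
      (use smt tent_nonneg tent_outside in auto)
  have "0 \<le> I"
  proof (rule ccontr)
    assume "\<not> 0 \<le> I"
    \<comment> \<open>This size makes the negative linear term win over the quadratic one.\<close>
    define \<epsilon> where "\<epsilon> = - I / (C\<^sup>2 + 1)"
    have \<epsilon>: "0 < \<epsilon>" using \<open>\<not> 0 \<le> I\<close> by (simp add: \<epsilon>_def divide_neg_pos add_nonneg_pos)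
    have "\<epsilon> * (C\<^sup>2 + 1) = - I" using add_nonneg_pos[of "C\<^sup>2" 1] by (simp add: \<epsilon>_def)
    moreover have "2 * \<epsilon> * I + \<epsilon>\<^sup>2 * C\<^sup>2 = 2 * \<epsilon> * I + \<epsilon> * (\<epsilon> * (C\<^sup>2 + 1)) - \<epsilon> * \<epsilon>"
      by (simp add: power2_eq_square algebra_simps)
    ultimately have "2 * \<epsilon> * I + \<epsilon>\<^sup>2 * C\<^sup>2 = \<epsilon> * (I - \<epsilon>)" by (simp add: algebra_simps)
    moreover have "\<epsilon> * (I - \<epsilon>) < 0" using \<epsilon> \<open>\<not> 0 \<le> I\<close> by (intro mult_pos_neg) auto
    ultimately show False using \<open>\<And>\<epsilon>. 0 \<le> \<epsilon> \<Longrightarrow> 0 \<le> 2 * \<epsilon> * I + \<epsilon>\<^sup>2 * C\<^sup>2\<close>[of \<epsilon>] \<epsilon> by linarith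
  qed
  then show ?thesis by (simp add: I_def)
qed

text \<open>
  If the mass is affine on the three nodes, then the source cost changes only at second order in \<open>\<epsilon>\<close>. The decrease of the action,
  however, is at least \<open>\<epsilon>\<close> times the integral of a positive weight against the action, because \<open>\<mu> + \<epsilon> G p \<ge> (1 + \<epsilon> \<kappa> G) \<mu>\<close> and the
  action is homogeneous of degree \<open>-1\<close> in the density. Letting \<open>\<epsilon> \<rightarrow> 0\<close> leaves no room for any flux.
\<close>

lemma optimal_no_flux_on_affine_mass:
  assumes CE: "(\<mu>, V, h) \<in> CE K p \<mu>0 \<mu>1"
    and opt: "E_Quad K w a b \<mu> V h = W_squared K w p a b \<mu>0 \<mu>1"
    and fin: "E_Quad K w a b \<mu> V h < \<infinity>"
    and smt: "0 \<le> s" "s < m" "m < t" "t \<le> 1"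
    and affine: "(mass \<mu> t - mass \<mu> m) / (t - m) = (mass \<mu> m - mass \<mu> s) / (m - s)"
  shows "AE \<tau> in lebesgue_on {0..1}. s < \<tau> \<and> \<tau> < t \<longrightarrow> flux_action K w (\<mu> \<tau>) (V \<tau>) = 0"
proof -
  note D = CE_D[OF CE]
  let ?M = "lebesgue_on {0..1::real}"
  let ?G = "tent s m t"
  let ?A = "\<lambda>\<tau>. flux_action K w (\<mu> \<tau>) (V \<tau>)"
  let ?B = "\<lambda>\<epsilon> \<tau>. flux_action K w (\<lambda>x. \<mu> \<tau> x + \<epsilon> * ?G \<tau> * p x) (V \<tau>)"
  define C where "C = 1 / (m - s) + 1 / (t - m)"
  have AEd: "AE \<tau> in ?M. (?G has_real_derivative tent_slope s m t \<tau>) (at \<tau> within {0..1})"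
    by (rule tent_has_derivative_AE[OF smt(2,3)])
  have hg: "((\<lambda>\<tau>. h \<tau> * tent_slope s m t \<tau>) has_integral 0) {0..1}"
    using mass_tent_integral[OF CE smt] affine by simp
  note pert = optimal_perturbation[OF CE opt fin tent_abs_continuous[OF smt(2,3)] _ _ _ tent_slope_measurable[of s m t] AEd
          tent_slope_bounded[OF smt(2,3), folded C_def] hg]
  have bound: "ennreal (b\<^sup>2) * (\<integral>\<^sup>+\<tau>. ?A \<tau> \<partial>?M) \<le> ennreal (a\<^sup>2 * (\<epsilon>\<^sup>2 * C\<^sup>2)) + ennreal (b\<^sup>2) * (\<integral>\<^sup>+\<tau>. ?B \<epsilon> \<tau> \<partial>?M)"
    if "0 \<le> \<epsilon>" for \<epsilon>
    using pert(1)[of \<epsilon>] that smt tent_nonneg tent_outside[OF smt(2,3)] by simp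
  have finA: "(\<integral>\<^sup>+\<tau>. ?A \<tau> \<partial>?M) < \<infinity>"
    using pert(3)[of 0] smt tent_nonneg tent_outside[OF smt(2,3)] by simp
  obtain \<kappa> where \<kappa>: "0 < \<kappa>" "\<And>\<tau> x. \<tau> \<in> {0..1} \<Longrightarrow> \<kappa> * \<mu> \<tau> x \<le> p x"
  proof -
    have "\<exists>\<kappa>>0. \<forall>\<tau>\<in>{0..1}. \<kappa> * \<mu> \<tau> x \<le> p x" for x
    proof -
      have "compact ((\<lambda>\<tau>. \<mu> \<tau> x) ` {0..1})"
        using abs_continuous_imp_continuous_on[OF D(2)] by (intro compact_continuous_image) auto
      then obtain B where B: "\<And>\<tau>. \<tau> \<in> {0..1} \<Longrightarrow> \<mu> \<tau> x \<le> B"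
        using compact_imp_bounded bounded_imp_bdd_above by (metis bdd_above.E imageI)
      have "0 \<le> B" using B[of 0] D(1)[of 0 x] by simp
      have "p x / (B + 1) * \<mu> \<tau> x \<le> p x" if "\<tau> \<in> {0..1}" for \<tau>
      proof -
        have "p x / (B + 1) * \<mu> \<tau> x \<le> p x / (B + 1) * (B + 1)"
          using B[OF that] \<open>0 \<le> B\<close> p_pos[of x] by (intro mult_left_mono) auto
        then show ?thesis using \<open>0 \<le> B\<close> by simp
      qed
      then show ?thesis using \<open>0 \<le> B\<close> p_pos[of x] by (intro exI[of _ "p x / (B + 1)"]) auto
    qed
    then obtain k where k: "\<And>x. 0 < k x" "\<And>x \<tau>. \<tau> \<in> {0..1} \<Longrightarrow> k x * \<mu> \<tau> x \<le> p x" by metis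
    have "Min (range k) * \<mu> \<tau> x \<le> p x" if "\<tau> \<in> {0..1}" for \<tau> x
      using mult_right_mono[of "Min (range k)" "k x" "\<mu> \<tau> x"] k(2)[OF that, of x] D(1)[OF that, of x] by simp
    moreover have "0 < Min (range k)" using k(1) by simp
    ultimately show ?thesis using that by blast
  qed
  \<comment> \<open>A weight independent of \<open>\<epsilon>\<close> that bounds the relative gain in action per unit of \<open>\<epsilon>\<close> from below when \<open>\<epsilon> \<le> 1\<close>.\<close>
  define \<rho> where "\<rho> = (\<lambda>\<tau>. \<kappa> * ?G \<tau> / (1 + \<kappa> * ?G \<tau>))"
  have G0: "0 \<le> \<kappa> * ?G \<tau>" for \<tau> using \<kappa> tent_nonneg by simp
  have pointwise: "?B \<epsilon> \<tau> + ennreal \<epsilon> * (ennreal (\<rho> \<tau>) * ?A \<tau>) \<le> ?A \<tau>"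
    if \<tau>: "\<tau> \<in> {0..1}" and \<epsilon>: "0 < \<epsilon>" "\<epsilon> \<le> 1" for \<tau> \<epsilon>
  proof -
    let ?k = "\<kappa> * ?G \<tau>"
    have k0: "0 \<le> \<epsilon> * ?k" "\<epsilon> * ?k \<le> ?k" using G0[of \<tau>] \<epsilon> mult_right_mono[of \<epsilon> 1 ?k] by auto
    have "?B \<epsilon> \<tau> \<le> flux_action K w (\<lambda>x. (1 + \<epsilon> * ?k) * \<mu> \<tau> x) (V \<tau>)"
    proof (rule flux_action_antimono)
      fix x
      show "0 \<le> (1 + \<epsilon> * ?k) * \<mu> \<tau> x" using k0 D(1)[OF \<tau>] by simp
      have "\<epsilon> * ?G \<tau> * (\<kappa> * \<mu> \<tau> x) \<le> \<epsilon> * ?G \<tau> * p x"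
        using \<epsilon> tent_nonneg \<kappa>(2)[OF \<tau>] by (intro mult_left_mono) auto
      then show "(1 + \<epsilon> * ?k) * \<mu> \<tau> x \<le> \<mu> \<tau> x + \<epsilon> * ?G \<tau> * p x" by (simp add: algebra_simps)
    qed
    also have "\<dots> = ennreal (1 / (1 + \<epsilon> * ?k)) * ?A \<tau>"
      using k0 D(1)[OF \<tau>] by (intro flux_action_scale_density) auto
    finally have "?B \<epsilon> \<tau> + ennreal \<epsilon> * (ennreal (\<rho> \<tau>) * ?A \<tau>)
        \<le> ennreal (1 / (1 + \<epsilon> * ?k)) * ?A \<tau> + ennreal (\<epsilon> * \<rho> \<tau>) * ?A \<tau>"
      using \<epsilon> by (simp add: ennreal_mult' mult.assoc)
    also have "\<dots> = ennreal (1 / (1 + \<epsilon> * ?k) + \<epsilon> * \<rho> \<tau>) * ?A \<tau>"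
      using k0 G0[of \<tau>] \<epsilon> by (subst ennreal_plus) (auto simp: \<rho>_def distrib_right)
    also have "\<dots> \<le> ennreal 1 * ?A \<tau>"
    proof (intro mult_right_mono ennreal_leI)
      have "\<epsilon> * \<rho> \<tau> = \<epsilon> * ?k / (1 + ?k)" by (simp add: \<rho>_def)
      also have "\<dots> \<le> \<epsilon> * ?k / (1 + \<epsilon> * ?k)" using k0 G0[of \<tau>] by (intro divide_left_mono) auto
      finally have "1 / (1 + \<epsilon> * ?k) + \<epsilon> * \<rho> \<tau> \<le> (1 + \<epsilon> * ?k) / (1 + \<epsilon> * ?k)"
        unfolding add_divide_distrib by linarith
      then show "1 / (1 + \<epsilon> * ?k) + \<epsilon> * \<rho> \<tau> \<le> 1" using k0 by simp
    qed simp
    finally show ?thesis by simp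
  qed
  have mA: "?A \<in> borel_measurable ?M" by (rule measurable_CE_flux_action[OF CE])
  have "(\<lambda>\<tau>. \<rho> \<tau>) \<in> borel_measurable ?M"
    using abs_continuous_measurable[OF tent_abs_continuous[OF smt(2,3)]] unfolding \<rho>_def by simp
  then have mQ: "(\<lambda>\<tau>. ennreal (\<rho> \<tau>) * ?A \<tau>) \<in> borel_measurable ?M" using mA by simp
  have mB: "?B \<epsilon> \<in> borel_measurable ?M" if "0 < \<epsilon>" for \<epsilon>
    by (intro measurable_flux_action D(5) borel_measurable_add borel_measurable_times borel_measurable_const
        abs_continuous_measurable D(2) tent_abs_continuous[OF smt(2,3)])
      (use that p_pos tent_nonneg D(1) in \<open>simp add: less_imp_le\<close>)
  obtain Q where Q: "(\<integral>\<^sup>+\<tau>. ennreal (\<rho> \<tau>) * ?A \<tau> \<partial>?M) = ennreal Q" "0 \<le> Q"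
  proof -
    have "(\<integral>\<^sup>+\<tau>. ennreal (\<rho> \<tau>) * ?A \<tau> \<partial>?M) \<le> (\<integral>\<^sup>+\<tau>. ?A \<tau> \<partial>?M)"
    proof (rule nn_integral_mono)
      fix \<tau> assume "\<tau> \<in> space ?M"
      then show "ennreal (\<rho> \<tau>) * ?A \<tau> \<le> ?A \<tau>"
        using pointwise[of \<tau> 1] by (simp add: order_trans[OF _ pointwise[of \<tau> 1]])
    qed
    then show ?thesis using finA that by (cases "\<integral>\<^sup>+\<tau>. ennreal (\<rho> \<tau>) * ?A \<tau> \<partial>?M") auto
  qed
  have "b\<^sup>2 * Q \<le> \<epsilon> * (a\<^sup>2 * C\<^sup>2)" if \<epsilon>: "0 < \<epsilon>" "\<epsilon> \<le> 1" for \<epsilon>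
  proof -
    have "(\<integral>\<^sup>+\<tau>. ?B \<epsilon> \<tau> \<partial>?M) + ennreal \<epsilon> * ennreal Q = (\<integral>\<^sup>+\<tau>. ?B \<epsilon> \<tau> + ennreal \<epsilon> * (ennreal (\<rho> \<tau>) * ?A \<tau>) \<partial>?M)"
      using mB[OF \<epsilon>(1)] mQ by (simp add: nn_integral_add nn_integral_cmult Q(1)[symmetric])
    also have "\<dots> \<le> (\<integral>\<^sup>+\<tau>. ?A \<tau> \<partial>?M)"
      using pointwise \<epsilon> by (intro nn_integral_mono) auto
    finally have le: "(\<integral>\<^sup>+\<tau>. ?B \<epsilon> \<tau> \<partial>?M) + ennreal \<epsilon> * ennreal Q \<le> (\<integral>\<^sup>+\<tau>. ?A \<tau> \<partial>?M)" .
    obtain A0 where A0: "(\<integral>\<^sup>+\<tau>. ?A \<tau> \<partial>?M) = ennreal A0" "0 \<le> A0"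
      using finA by (cases "\<integral>\<^sup>+\<tau>. ?A \<tau> \<partial>?M") auto
    obtain B0 where B0: "(\<integral>\<^sup>+\<tau>. ?B \<epsilon> \<tau> \<partial>?M) = ennreal B0" "0 \<le> B0"
      using le A0 by (cases "\<integral>\<^sup>+\<tau>. ?B \<epsilon> \<tau> \<partial>?M") (auto simp: top_unique)
    have "ennreal (B0 + \<epsilon> * Q) \<le> ennreal A0"
      using le A0 B0 Q \<epsilon> by (simp add: ennreal_mult)
    then have 1: "B0 + \<epsilon> * Q \<le> A0" using A0 by (simp add: ennreal_le_iff)
    have "ennreal (b\<^sup>2 * A0) \<le> ennreal (a\<^sup>2 * (\<epsilon>\<^sup>2 * C\<^sup>2) + b\<^sup>2 * B0)"
      using bound[of \<epsilon>] \<epsilon> A0 B0 by (simp add: ennreal_mult)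
    then have 2: "b\<^sup>2 * A0 \<le> a\<^sup>2 * (\<epsilon>\<^sup>2 * C\<^sup>2) + b\<^sup>2 * B0"
      by (rule ennreal_le_iff[THEN iffD1, rotated]) (use B0 in simp)
    have "b\<^sup>2 * (B0 + \<epsilon> * Q) \<le> b\<^sup>2 * A0" using 1 by (intro mult_left_mono) auto
    with 2 have "\<epsilon> * (b\<^sup>2 * Q) \<le> \<epsilon> * (\<epsilon> * (a\<^sup>2 * C\<^sup>2))" by (simp add: algebra_simps power2_eq_square)
    then show ?thesis using \<epsilon> by (simp add: mult_le_cancel_left)
  qed
  then have "b\<^sup>2 * Q \<le> 0"
  proof -
    assume le: "\<And>\<epsilon>. 0 < \<epsilon> \<Longrightarrow> \<epsilon> \<le> 1 \<Longrightarrow> b\<^sup>2 * Q \<le> \<epsilon> * (a\<^sup>2 * C\<^sup>2)"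
    show ?thesis
    proof (rule tendsto_lowerbound)
      show "((\<lambda>\<epsilon>. \<epsilon> * (a\<^sup>2 * C\<^sup>2)) \<longlongrightarrow> 0) (at_right 0)" by (intro tendsto_eq_intros) auto
      show "\<forall>\<^sub>F \<epsilon> in at_right 0. b\<^sup>2 * Q \<le> \<epsilon> * (a\<^sup>2 * C\<^sup>2)"
        unfolding eventually_at_right_field by (intro exI[of _ 1]) (auto intro: le)
    qed simp
  qed
  then have "Q = 0" using Q(2) b_pos by (simp add: mult_le_0_iff)
  then have "AE \<tau> in ?M. ennreal (\<rho> \<tau>) * ?A \<tau> = 0"
    using Q(1) mQ by (simp add: nn_integral_0_iff_AE)
  then show ?thesis
  proof eventually_elim
    case (elim \<tau>)
    show ?case
    proof
      assume "s < \<tau> \<and> \<tau> < t"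
      then have "0 < \<kappa> * ?G \<tau>" using tent_pos[OF smt(2,3)] \<kappa> by simp
      then have "0 < \<rho> \<tau>" by (simp add: \<rho>_def)
      then show "?A \<tau> = 0" using elim by simp
    qed
  qed
qed

section \<open>Positivity of optimal curves\<close>

text \<open>
  At a zero of the density both the time derivative and the divergence of the flux vanish, and the source is all that is left
  of the continuity equation.
\<close>

lemma source_vanishes_at_zeros:
  assumes nonneg: "\<And>s y. s \<in> {0..1} \<Longrightarrow> 0 \<le> \<mu> s y" and t: "0 < t" "t < 1" and zero: "\<mu> t x = 0"
    and fin: "flux_action K w (\<mu> t) U \<noteq> \<infinity>"
    and der: "((\<lambda>s. \<mu> s x) has_real_derivative r * p x - discrete_div K U x) (at t within {0..1})"
  shows "r = 0"
proof -
  have "((\<lambda>s. \<mu> s x) has_real_derivative r * p x - discrete_div K U x) (at t)"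
    using der t at_within_interior[of t "{0..1}"] by simp
  then have "r * p x - discrete_div K U x = 0"
    by (rule DERIV_local_min[of _ _ _ "min t (1 - t)"]) (use t nonneg zero in \<open>auto simp: abs_if split: if_splits\<close>)
  moreover have "discrete_div K U x = 0"
    using finite_flux_action_degenerate_edge[OF fin] K_pos_commute w_pos zero
    by (intro discrete_div_eq_0) auto
  ultimately show ?thesis using p_pos[of x] by simp
qed

text \<open>
  A concave function lies below its horizontal tangents.
\<close>

lemma optimal_mass_max_at_critical:
  assumes CE: "(\<mu>, V, h) \<in> CE K p \<mu>0 \<mu>1"
    and opt: "E_Quad K w a b \<mu> V h = W_squared K w p a b \<mu>0 \<mu>1"
    and fin: "E_Quad K w a b \<mu> V h < \<infinity>"
    and t: "0 < t" "t < 1" and der: "(mass \<mu> has_real_derivative 0) (at t within {0..1})"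
    and u: "u \<in> {0..1}"
  shows "mass \<mu> u \<le> mass \<mu> t"
proof -
  have "convex_on {0..1} (\<lambda>s. - mass \<mu> s)"
  proof (rule convex_on_linorderI)
    fix l x y :: real
    assume l: "0 < l" "l < 1" and xy: "x \<in> {0..1}" "y \<in> {0..1}" "x < y"
    define z where "z = (1 - l) *\<^sub>R x + l *\<^sub>R y"
    have z: "z - x = l * (y - x)" "y - z = (1 - l) * (y - x)" by (simp_all add: z_def algebra_simps)
    then have zx: "0 < z - x" "0 < y - z" using l xy by auto
    have "(mass \<mu> y - mass \<mu> z) / (y - z) \<le> (mass \<mu> z - mass \<mu> x) / (z - x)"
      by (rule optimal_mass_concave[OF CE opt fin]) (use zx xy in auto)
    then have "(mass \<mu> y - mass \<mu> z) * (z - x) \<le> (mass \<mu> z - mass \<mu> x) * (y - z)"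
      using zx by (simp add: divide_le_eq pos_le_divide_eq field_simps)
    then have "(y - x) * ((mass \<mu> y - mass \<mu> z) * l) \<le> (y - x) * ((mass \<mu> z - mass \<mu> x) * (1 - l))"
      unfolding z by (simp add: mult_ac)
    then have "(mass \<mu> y - mass \<mu> z) * l \<le> (mass \<mu> z - mass \<mu> x) * (1 - l)"
      using xy by (simp add: mult_le_cancel_left)
    then show "- mass \<mu> ((1 - l) *\<^sub>R x + l *\<^sub>R y) \<le> (1 - l) * - mass \<mu> x + l * - mass \<mu> y"
      unfolding z_def[symmetric] by (simp add: algebra_simps)
  qed simp
  from convex_on_imp_above_tangent[OF this _ _ u, of t 0] show ?thesis
    using t DERIV_minus[OF der] by simp
qed

text \<open>
  If the curve were not positive at almost every time, then there would be two times with zeros at which the equation holds and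
  the action is finite. Between them the curve would pause.
\<close>

lemma optimal_positive:
  assumes CE: "(\<mu>, V, h) \<in> CE K p \<mu>0 \<mu>1"
    and opt: "E_Quad K w a b \<mu> V h = W_squared K w p a b \<mu>0 \<mu>1"
    and dens: "\<mu>0 \<in> densities" "\<mu>1 \<in> densities" and neq: "\<mu>0 \<noteq> \<mu>1"
  shows "AE t in lebesgue_on {0..1}. \<mu> t \<in> pos_densities"
proof (rule ccontr)
  assume not_pos: "\<not> ?thesis"
  let ?M = "lebesgue_on {0..1::real}"
  note D = CE_D[OF CE]
  have fin: "E_Quad K w a b \<mu> V h < \<infinity>" unfolding opt by (rule W_squared_finite[OF dens])
  have eM: "energy_density \<mu> V h \<in> borel_measurable ?M" by (rule measurable_energy_density[OF CE])
  have "AE t in ?M. flux_action K w (\<mu> t) (V t) \<noteq> \<infinity>"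
  proof -
    have "AE t in ?M. energy_density \<mu> V h t \<noteq> \<infinity>"
      using fin by (intro nn_integral_noteq_infinite eM) (simp add: E_Quad_eq_integral[OF CE])
    then show ?thesis
      by (rule eventually_mono) (use b_pos in \<open>auto simp: energy_density_def ennreal_mult_eq_top_iff\<close>)
  qed
  then have "AE t in ?M. flux_action K w (\<mu> t) (V t) \<noteq> \<infinity> \<and> (\<forall>x. ((\<lambda>s. \<mu> s x) has_real_derivative
      h t * p x - discrete_div K (V t) x) (at t within {0..1}))"
    using D(7) by eventually_elim simp
  then obtain N where N: "negligible N"
    and fin_action: "\<And>t. t \<in> {0..1} - N \<Longrightarrow> flux_action K w (\<mu> t) (V t) \<noteq> \<infinity>"
    and der: "\<And>t x. t \<in> {0..1} - N \<Longrightarrow> ((\<lambda>s. \<mu> s x) has_real_derivative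
      h t * p x - discrete_div K (V t) x) (at t within {0..1})"
    by (subst (asm) AE_lebesgue_on_iff_negligible) auto
  \<comment> \<open>Interior times with a zero at which the equation holds and the action is finite.\<close>
  define Z where "Z = {t\<in>{0..1} - (N \<union> {0, 1}). \<mu> t \<notin> pos_densities}"
  have "infinite Z"
  proof
    assume "finite Z"
    then have "negligible (Z \<union> (N \<union> {0, 1}))" using N by (simp add: negligible_finite)
    moreover have "\<forall>t\<in>{0..1} - (Z \<union> (N \<union> {0, 1})). \<mu> t \<in> pos_densities" by (auto simp: Z_def)
    ultimately have "AE t in ?M. \<mu> t \<in> pos_densities"
      by (intro AE_lebesgue_on_iff_negligible[THEN iffD2, OF _ exI, OF _ conjI]) simp_all
    then show False using not_pos by simp
  qed
  then obtain s t where st: "s \<in> Z" "t \<in> Z" "s < t"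
    by (metis infinite_imp_nonempty all_not_in_conv finite.simps finite_subset insertI1 linorder_neqE singletonD subset_iff subset_singleton_iff)
  have critical: "(mass \<mu> has_real_derivative 0) (at t within {0..1})" if "t \<in> Z" for t
  proof -
    have t: "0 < t" "t < 1" "t \<in> {0..1} - N" using that by (auto simp: Z_def less_le)
    obtain x where "\<not> 0 < \<mu> t x" using \<open>t \<in> Z\<close> by (auto simp: Z_def pos_densities_def)
    then have "\<mu> t x = 0" using D(1)[of t x] t by simp
    then have "h t = 0"
      using source_vanishes_at_zeros[OF D(1) t(1,2) _ fin_action[OF t(3)] der[OF t(3)]] by blast
    then show ?thesis using mass_derivative[OF der[OF t(3)]] by simp
  qed
  have s01: "0 < s" and t01: "t < 1" using st by (auto simp: Z_def less_le)
  have max_s: "mass \<mu> u \<le> mass \<mu> s" and max_t: "mass \<mu> u \<le> mass \<mu> t" if "u \<in> {0..1}" for u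
    using optimal_mass_max_at_critical[OF CE opt fin _ _ critical that] st s01 t01 by auto
  have eq_st: "mass \<mu> s = mass \<mu> t" using max_s[of t] max_t[of s] st s01 t01 by force
  have flat: "mass \<mu> u = mass \<mu> s" if u: "s \<le> u" "u \<le> t" for u
  proof (cases "u = s \<or> u = t")
    case False
    then have u': "s < u" "u < t" using u by auto
    have "(mass \<mu> t - mass \<mu> u) / (t - u) \<le> (mass \<mu> u - mass \<mu> s) / (u - s)"
      by (rule optimal_mass_concave[OF CE opt fin]) (use u' s01 t01 in auto)
    moreover have le: "mass \<mu> u \<le> mass \<mu> s" using max_s[of u] u s01 t01 by auto
    moreover have "(mass \<mu> u - mass \<mu> s) / (u - s) \<le> 0" using le u' by (intro divide_nonpos_pos) auto
    ultimately have "(mass \<mu> t - mass \<mu> u) / (t - u) \<le> 0" by linarith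
    then have "mass \<mu> t \<le> mass \<mu> u" using u' by (simp add: divide_le_0_iff)
    then show ?thesis using le eq_st by simp
  qed (use eq_st in auto)
  have noflux: "AE \<tau> in ?M. s < \<tau> \<and> \<tau> < t \<longrightarrow> flux_action K w (\<mu> \<tau>) (V \<tau>) = 0"
    by (rule optimal_no_flux_on_affine_mass[OF CE opt fin, of s "(s + t) / 2" t])
      (use st s01 t01 flat[of t] flat[of "(s + t) / 2"] in auto)
  have nosource: "h \<tau> = 0" if "s < \<tau>" "\<tau> < t" "\<tau> \<in> {0..1} - N" for \<tau>
  proof -
    have "(mass \<mu> has_real_derivative h \<tau>) (at \<tau>)"
      using mass_derivative[OF der[OF that(3)]] that s01 t01 at_within_interior[of \<tau> "{0..1}"] by simp
    moreover have "(mass \<mu> has_real_derivative 0) (at \<tau>)"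
    proof (rule has_field_derivative_transform_within_open[where f = "\<lambda>_. mass \<mu> s" and S = "{s<..<t}"])
      show "mass \<mu> s = mass \<mu> u" if "u \<in> {s<..<t}" for u
        using flat[of u] that by simp
    qed (use that in auto)
    ultimately show ?thesis by (rule DERIV_unique)
  qed
  have no_energy: "AE \<tau> in ?M. s < \<tau> \<and> \<tau> < t \<longrightarrow> energy_density \<mu> V h \<tau> = 0"
    using noflux AE_lebesgue_on_negligible[OF N, of "{0..1}", simplified] AE_space
    by eventually_elim (use nosource in \<open>auto simp: energy_density_def\<close>)
  have "(\<integral>\<^sup>+\<tau>. energy_density \<mu> V h \<tau> * indicator {0..t} \<tau> \<partial>?M) = (\<integral>\<^sup>+\<tau>. energy_density \<mu> V h \<tau> * indicator {0..s} \<tau> \<partial>?M)"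
  proof (rule nn_integral_cong_AE)
    have "AE \<tau> in ?M. \<tau> \<notin> {t}" by (rule AE_lebesgue_on_negligible) auto
    with no_energy show "AE \<tau> in ?M. energy_density \<mu> V h \<tau> * indicator {0..t} \<tau> = energy_density \<mu> V h \<tau> * indicator {0..s} \<tau>"
      by eventually_elim (use st in \<open>auto simp: indicator_def\<close>)
  qed
  then have eq: "ennreal t * E_Quad K w a b \<mu> V h = ennreal s * E_Quad K w a b \<mu> V h"
    using optimal_constant_speed[OF CE opt fin, of t] optimal_constant_speed[OF CE opt fin, of s] st s01 t01 by simp
  obtain E where E: "E_Quad K w a b \<mu> V h = ennreal E" "0 \<le> E" using fin
    by (cases "E_Quad K w a b \<mu> V h") simp_all
  have "t * E = s * E"
    using eq E s01 st by (simp add: ennreal_mult[symmetric])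
  then have "E = 0" using st by simp
  then show False using zero_energy_constant[OF CE] E neq by simp
qed

end

theorem theorem3p8:
  fixes K :: "'a::finite \<Rightarrow> 'a \<Rightarrow> real"
    and w p \<mu>0 \<mu>1 :: "'a \<Rightarrow> real"
    and a b :: real
    and \<mu> :: "real \<Rightarrow> 'a \<Rightarrow> real"
    and V :: "real \<Rightarrow> 'a \<Rightarrow> 'a \<Rightarrow> real"
    and h :: "real \<Rightarrow> real"
  assumes "markov_kernel K" and "irreducible_kernel K"
    and "invariant_probability K w" and "reversible_kernel K w"
    and "0 < a" and "0 < b"
    and "p \<in> pos_densities" and "(\<Sum>x\<in>UNIV. p x * w x) = 1"
    and "\<mu>0 \<in> densities" and "\<mu>1 \<in> densities" and "\<mu>0 \<noteq> \<mu>1"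
    and "(\<mu>, V, h) \<in> CE K p \<mu>0 \<mu>1"
    and "E_Quad K w a b \<mu> V h = W_squared K w p a b \<mu>0 \<mu>1"
  shows "AE t in lebesgue_on {0..1}. \<mu> t \<in> pos_densities"
proof -
  interpret transport_setting K w p a b
    by unfold_locales (fact assms)+
  show ?thesis using assms by (intro optimal_positive)
qed

end
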